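(* Let $n$ be a positive integer, and let $a,b,k$ be nonnegative integers and $m,n_0$ integers with $0\le m,n_0\le n\le m+n_0$. Let $\mathbf B=(\beta_{ij})_{0\le i,j\le n}$ be the matrix with $\beta_{ii}=0$, $\beta_{0j}=b$ for $1\le j\le n$, $\beta_{i0}=a$ for $1\le i\le n-m$, $\beta_{i0}=a+1$ for $n-m<i\le n$, and for $1\le i\ne j\le n$: $\beta_{ij}=k+1$ if both $i,j>n_0$, and $\beta_{ij}=k$ otherwise. Define \[ \mathcal{L}_q(x_0,\mathbf x;\mathbf B)=\prod_{0\le i<j\le n}\left(\frac{x_i}{x_j}\right)_{\beta_{ij}}\left(\frac{qx_j}{x_i}\right)_{\beta_{ji}}. \] Then \[ \mathrm{CT}[\mathcal{L}_q(x_0,\mathbf x;\mathbf B)]=\prod_{j=0}^{n-1}\frac{(q)_{a+b+kj+\chi(j>n_0)(j-n_0)+\chi(j\ge n-m)}\,(q)_{kj+\chi(j>n_0)(j-n_0)+k}}{(q)_{a+kj+\chi(j>n_0)(j-n_0)+\chi(j\ge n-m)}\,(q)_{b+kj+\chi(j>n_0)(j-n_0)}\,(q)_k}\times\prod_{j=1}^{n-n_0}\frac{1-q^{(k+1)j}}{1-q^{k+1}}. \]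
   Context: $q,x_0,x_1,\dots,x_n$ are independent indeterminates; $\mathrm{CT}$ denotes the constant term with respect to $x_0,\dots,x_n$ of a Laurent polynomial with coefficients in $\mathbb{Q}(q)$. $(t)_k=(1-t)(1-tq)\cdots(1-tq^{k-1})$ with $(t)_0=1$. $\chi(S)$ equals $1$ if $S$ is true and $0$ otherwise. An empty product equals $1$. *)

theory Defs
  imports
    "HOL-Library.Poly_Mapping"
    "HOL-Computational_Algebra.Polynomial"
    "HOL-Computational_Algebra.Fraction_Field"
begin

type_synonym ratfun = "rat poly fract"

definition q_ind :: ratfun where
  "q_ind = Fract [:0, 1:] 1"

text \<open>
  Laurent polynomials in indeterminates \<open>x\<^sub>0, x\<^sub>1, \<dots>\<close>: the group algebra of the free abelian group
  of (finitely supported) exponent vectors. Any number of indeterminates is available in the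
  type; a Laurent polynomial in \<open>x\<^sub>0, \<dots>, x\<^sub>n\<close> is one in which only these occur.
\<close>

type_synonym laurent = "(nat \<Rightarrow>\<^sub>0 int) \<Rightarrow>\<^sub>0 ratfun"

definition lconst :: "ratfun \<Rightarrow> laurent" where
  "lconst c = Poly_Mapping.single 0 c"

definition xvar :: "nat \<Rightarrow> laurent" where
  "xvar i = Poly_Mapping.single (Poly_Mapping.single i 1) 1"

definition xquot :: "nat \<Rightarrow> nat \<Rightarrow> laurent" where
  "xquot i j = Poly_Mapping.single (Poly_Mapping.single i 1 - Poly_Mapping.single j 1) 1"

lemma xquot_mult_xvar: "xquot i j * xvar j = xvar i"
  by (simp add: xquot_def xvar_def mult_single)

definition CT :: "laurent \<Rightarrow> ratfun" where
  "CT p = Poly_Mapping.lookup p 0"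

definition qpoch :: "'a::comm_ring_1 \<Rightarrow> 'a \<Rightarrow> nat \<Rightarrow> 'a" where
  "qpoch q t k = (\<Prod>i<k. 1 - t * q ^ i)"

definition Lq :: "nat \<Rightarrow> (nat \<Rightarrow> nat \<Rightarrow> nat) \<Rightarrow> laurent" where
  "Lq n B = (\<Prod>(i, j) \<in> {(i, j). i < j \<and> j \<le> n}.
     qpoch (lconst q_ind) (xquot i j) (B i j) *
     qpoch (lconst q_ind) (lconst q_ind * xquot j i) (B j i))"

lemma finite_Lq_index: "finite {(i, j). i < j \<and> j \<le> (n::nat)}"
  by (rule finite_subset[of _ "{..n} \<times> {..n}"]) auto

abbreviation qfact :: "nat \<Rightarrow> ratfun" where
  "qfact k \<equiv> qpoch q_ind q_ind k"

lemma q_ind_power: "q_ind ^ k = Fract (monom 1 k) 1"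
  by (induction k) (simp_all add: q_ind_def One_fract_def monom_Suc monom_0 flip: one_pCons)

lemma one_minus_q_power_nonzero: "k > 0 \<Longrightarrow> 1 - q_ind ^ k \<noteq> 0"
proof
  assume k: "k > 0" and "1 - q_ind ^ k = 0"
  then have "q_ind ^ k = 1" by simp
  then have "(monom 1 k :: rat poly) = 1"
    by (simp add: q_ind_power One_fract_def eq_fract)
  then have "degree (monom 1 k :: rat poly) = degree (1 :: rat poly)" by simp
  with k show False by (simp add: degree_monom_eq)
qed

lemma qfact_nonzero: "qfact k \<noteq> 0"
  using one_minus_q_power_nonzero[of "Suc _"] by (simp add: qpoch_def)

end

theory Submission
  imports Defs "HOL-Library.FuncSet" "HOL-Library.Infinite_Set"
begin

text \<open>
  Clear the denominators and interpolate in \<open>x\<^sub>1, \<dots>, x\<^sub>n\<close> on grids of powers of \<open>q\<close>, keeping \<open>x\<^sub>0 = t\<close>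
  free. This yields a polynomial \<open>g(t)\<close> of degree at most \<open>na + m\<close> whose coefficient of
  \<open>t\<^bsup>na + m\<^esup>\<close> is the constant term. Put \<open>c\<^sub>j = kj + max(0, j - n\<^sub>0)\<close>. If the product does not vanish at a
  grid point \<open>x\<^sub>j = q\<^bsup>\<alpha> j\<^esup>\<close>, the exponents are spread out, and the \<open>i\<close>-th smallest one (counting from
  \<open>0\<close>) lies between \<open>c\<^sub>i\<close> and \<open>b + c\<^sub>i\<close>; hence every summand of \<open>g\<close> is divisible by the monic polynomial
  \<open>H\<close> of degree \<open>na + m\<close> with the roots \<open>q\<^bsup>c i + s\<^esup>\<close>, \<open>1 \<le> s \<le> a + \<chi>(i \<ge> n - m)\<close>. So \<open>g\<close> is the constant term
  times \<open>H\<close>. At \<open>t = 1\<close> only the grid point \<open>\<alpha>\<^sub>j = b + c\<^bsub>j-1\<^esub>\<close> contributes, and its contribution is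
  evaluated by telescoping.
\<close>

section \<open>Interpolation of Laurent polynomials\<close>

text \<open>\<open>p\<close> coincides with its Lagrange interpolant \<open>Q\<close>, and each
  \<open>N i\<close> is monic of degree \<open>card I - 1\<close>; compare coefficients in that
  degree.\<close>

lemma sum_Lagrange_eq_coeff:
  fixes p :: "'a::field poly" and v :: "'b \<Rightarrow> 'a"
  assumes fin: "finite I" and inj: "inj_on v I" and deg: "degree p < card I"
  shows "(\<Sum>i\<in>I. poly p (v i) / (\<Prod>l\<in>I - {i}. v i - v l)) = coeff p (card I - 1)"
proof -
  define N where "N i = (\<Prod>l\<in>I - {i}. [:- v l, 1:])" for i
  define D where "D i = (\<Prod>l\<in>I - {i}. v i - v l)" for i
  define Q where "Q = (\<Sum>i\<in>I. smult (poly p (v i) / D i) (N i))"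
  have D0: "D i \<noteq> 0" if "i \<in> I" for i
    using fin that inj by (auto simp: D_def inj_on_def)
  have degN: "degree (N i) = card I - 1" if "i \<in> I" for i
    using that fin by (simp add: N_def degree_prod_eq_sum_degree card_Diff_singleton)
  have lcN: "coeff (N i) (card I - 1) = 1" if "i \<in> I" for i
    using degN[OF that] lead_coeff_prod[of "\<lambda>l. [:- v l, 1:]" "I - {i}"] by (simp add: N_def)
  have evN: "poly (N i) (v l) = (if l = i then D i else 0)" if "i \<in> I" "l \<in> I" for i l
    using that fin by (auto simp: N_def D_def poly_prod intro!: prod_zero prod.cong)
  have degQ: "degree Q < card I"
  proof -
    have "degree Q \<le> card I - 1"
      unfolding Q_def
      by (rule degree_sum_le[OF fin]) (metis degN degree_smult_le)
    with deg show ?thesis by linarith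
  qed
  have "p = Q"
  proof (rule poly_eqI_degree[of "v ` I"])
    fix y assume "y \<in> v ` I"
    then obtain l where l: "l \<in> I" "y = v l" by auto
    have "poly Q y = (\<Sum>i\<in>I. if l = i then poly p (v l) else 0)"
      unfolding Q_def poly_sum using l D0 by (auto intro!: sum.cong simp: evN)
    then show "poly p y = poly Q y" using fin l by simp
  qed (use degQ deg inj in \<open>simp_all add: card_image\<close>)
  have "coeff Q (card I - 1) = (\<Sum>i\<in>I. poly p (v i) / D i * coeff (N i) (card I - 1))"
    by (simp add: Q_def coeff_sum)
  also have "\<dots> = (\<Sum>i\<in>I. poly p (v i) / D i)"
    by (rule sum.cong) (use lcN in auto)
  finally show ?thesis by (simp add: D_def flip: \<open>p = Q\<close>)
qed

section \<open>Evaluation of Laurent polynomials\<close>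

lemma poly_mapping_single_add_induct [case_names zero single_add]:
  assumes "P 0" and "\<And>f a b. P f \<Longrightarrow> P (Poly_Mapping.single a b + f)"
  shows "P (f :: 'a \<Rightarrow>\<^sub>0 'b::monoid_add)"
proof (induction f rule: update_induct)
  case (update f a b)
  then have "Poly_Mapping.update a b f = Poly_Mapping.single a b + f"
    by (intro poly_mapping_eqI) (auto simp: lookup_update lookup_add lookup_single when_def in_keys_iff)
  with update show ?case by (simp add: assms(2))
qed (rule assms(1))

text \<open>Since \<open>0 powi e\<close> is 0 for negative \<open>e\<close>, this is multiplicative
  only at points with nonzero coordinates, whence the hypothesis of
  \<open>leval_mult\<close>.\<close>

definition leval :: "nat \<Rightarrow> (nat \<Rightarrow> ratfun) \<Rightarrow> laurent \<Rightarrow> ratfun" where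
  "leval n x p = (\<Sum>e\<in>Poly_Mapping.keys p. Poly_Mapping.lookup p e *
     (\<Prod>i\<le>n. x i powi Poly_Mapping.lookup e i))"

lemma leval_0 [simp]: "leval n x 0 = 0"
  by (simp add: leval_def)

lemma leval_add: "leval n x (p + p') = leval n x p + leval n x p'"
  unfolding leval_def
  by (rule setsum_keys_plus_distrib[where f = "\<lambda>e c. c * (\<Prod>i\<le>n. x i powi Poly_Mapping.lookup e i)"])
    (simp_all add: algebra_simps)

lemma leval_diff: "leval n x (p - p') = leval n x p - leval n x p'"
  using leval_add[of n x "p - p'" p'] by simp

lemma leval_single:
  "leval n x (Poly_Mapping.single e c) = c * (\<Prod>i\<le>n. x i powi Poly_Mapping.lookup e i)"
  by (simp add: leval_def)

lemma leval_1 [simp]: "leval n x 1 = 1"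
  by (simp add: leval_single flip: single_one)

lemma leval_mult:
  assumes "\<And>i. i \<le> n \<Longrightarrow> x i \<noteq> 0"
  shows "leval n x (p * p') = leval n x p * leval n x p'"
proof (induction p rule: poly_mapping_single_add_induct)
  case (single_add f a b)
  have "leval n x (Poly_Mapping.single a b * p') = leval n x (Poly_Mapping.single a b) * leval n x p'"
  proof (induction p' rule: poly_mapping_single_add_induct)
    case (single_add f' a' b')
    have "(\<Prod>i\<le>n. x i powi Poly_Mapping.lookup (a + a') i) =
        (\<Prod>i\<le>n. x i powi Poly_Mapping.lookup a i) * (\<Prod>i\<le>n. x i powi Poly_Mapping.lookup a' i)"
      unfolding prod.distrib[symmetric]
      by (rule prod.cong) (auto simp: lookup_add power_int_add assms)
    with single_add show ?case
      by (simp add: leval_add leval_single distrib_left mult_single)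
  qed simp
  with single_add show ?case by (simp add: leval_add distrib_right)
qed simp

lemma leval_prod:
  assumes "\<And>i. i \<le> n \<Longrightarrow> x i \<noteq> 0"
  shows "leval n x (\<Prod>s\<in>S. f s) = (\<Prod>s\<in>S. leval n x (f s))"
  by (induction S rule: infinite_finite_induct) (simp_all add: leval_mult[OF assms])

lemma leval_lconst [simp]: "leval n x (lconst c) = c"
  by (simp add: lconst_def leval_single)

lemma leval_xquot:
  assumes "i \<le> n" "j \<le> n" "i \<noteq> j"
  shows "leval n x (xquot i j) = x i / x j"
proof -
  have "(\<Prod>l\<le>n. x l powi Poly_Mapping.lookup (Poly_Mapping.single i 1 - Poly_Mapping.single j 1) l) =
      (\<Prod>l\<le>n. (if i = l then x l else 1) * (if j = l then inverse (x l) else 1))"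
    using assms(3) by (intro prod.cong) (auto simp: lookup_minus lookup_single when_def power_int_minus)
  then show ?thesis
    using assms by (simp add: xquot_def leval_single prod.distrib divide_inverse)
qed

lemma leval_qpoch:
  assumes "\<And>i. i \<le> n \<Longrightarrow> x i \<noteq> 0"
  shows "leval n x (qpoch (lconst c) t l) = qpoch c (leval n x t) l"
proof -
  have *: "leval n x (lconst c ^ s) = c ^ s" for s
    by (induction s) (simp_all add: leval_mult[OF assms])
  show ?thesis
    by (simp add: qpoch_def leval_prod[OF assms] leval_diff leval_mult[OF assms] *)
qed

lemma leval_Lq:
  assumes "\<And>i. i \<le> n \<Longrightarrow> x i \<noteq> 0"
  shows "leval n x (Lq n B) = (\<Prod>(i, j) \<in> {(i, j). i < j \<and> j \<le> n}.
     qpoch q_ind (x i / x j) (B i j) * qpoch q_ind (q_ind * (x j / x i)) (B j i))"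
  unfolding Lq_def
  by (subst leval_prod[OF assms])
    (auto intro!: prod.cong simp: leval_mult[OF assms] leval_qpoch[OF assms] leval_xquot)

text \<open>\<open>d i\<close> bounds the power of x_i in the denominators. Homogeneity of degree 0
  ties the exponent of x_0 to the others, which later isolates the constant term.\<close>

definition balanced :: "nat \<Rightarrow> (nat \<Rightarrow> nat) \<Rightarrow> laurent \<Rightarrow> bool" where
  "balanced n d p \<longleftrightarrow> (\<forall>e\<in>Poly_Mapping.keys p. (\<Sum>i\<le>n. Poly_Mapping.lookup e i) = 0 \<and>
     (\<forall>i>n. Poly_Mapping.lookup e i = 0) \<and> (\<forall>i. - int (d i) \<le> Poly_Mapping.lookup e i))"

lemma balanced_1: "balanced n (\<lambda>_. 0) 1"
  by (simp add: balanced_def)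

lemma balanced_mono:
  assumes "balanced n d p" "\<And>l. d l \<le> d' l"
  shows "balanced n d' p"
proof -
  have "- int (d' l) \<le> y" if "- int (d l) \<le> y" for l y
    using that assms(2)[of l] by linarith
  with assms(1) show ?thesis unfolding balanced_def by blast
qed

lemma balanced_mult:
  assumes "balanced n d p" "balanced n d' p'"
  shows "balanced n (\<lambda>i. d i + d' i) (p * p')"
  unfolding balanced_def
proof
  fix e assume "e \<in> Poly_Mapping.keys (p * p')"
  then obtain u u' where e: "e = u + u'" and u: "u \<in> Poly_Mapping.keys p" "u' \<in> Poly_Mapping.keys p'"
    using keys_mult[of p p'] by blast
  note * = assms(1)[unfolded balanced_def, rule_format, OF u(1)]
    assms(2)[unfolded balanced_def, rule_format, OF u(2)]
  have "- int (d i + d' i) \<le> Poly_Mapping.lookup e i" for i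
    using *[THEN conjunct2, THEN conjunct2, THEN spec, of i] by (simp add: e lookup_add)
  with * show "(\<Sum>i\<le>n. Poly_Mapping.lookup e i) = 0 \<and> (\<forall>i>n. Poly_Mapping.lookup e i = 0) \<and>
      (\<forall>i. - int (d i + d' i) \<le> Poly_Mapping.lookup e i)"
    by (simp add: e lookup_add sum.distrib)
qed

lemma balanced_prod:
  assumes "\<And>s. s \<in> S \<Longrightarrow> balanced n (d s) (f s)"
  shows "balanced n (\<lambda>i. \<Sum>s\<in>S. d s i) (\<Prod>s\<in>S. f s)"
  using assms
  by (induction S rule: infinite_finite_induct) (simp_all add: balanced_1 balanced_mult)

text \<open>Each factor has only the exponent vectors 0 and that of x_i / x_j, so it adds at most
  one x_j to the denominator.\<close>

lemma balanced_qpoch: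
  assumes "i \<le> n" "j \<le> n" "i \<noteq> j"
  shows "balanced n (\<lambda>l. of_bool (l = j) * r) (qpoch (lconst c) (lconst c' * xquot i j) r)"
proof -
  have *: "lconst c ^ s = lconst (c ^ s)" for s
    by (induction s) (simp_all add: lconst_def mult_single)
  have "balanced n (\<lambda>l. of_bool (l = j)) (1 - lconst c' * xquot i j * lconst c ^ s)" for s
  proof -
    define u :: "nat \<Rightarrow>\<^sub>0 int" where "u = Poly_Mapping.single i 1 - Poly_Mapping.single j 1"
    have lu: "Poly_Mapping.lookup u l = of_bool (l = i) - of_bool (l = j)" for l
      by (auto simp: u_def lookup_minus lookup_single when_def)
    have "lconst c' * xquot i j * lconst c ^ s = Poly_Mapping.single u (c' * c ^ s)"
      unfolding * by (simp add: lconst_def xquot_def mult_single u_def)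
    then have "Poly_Mapping.keys (1 - lconst c' * xquot i j * lconst c ^ s) \<subseteq> {0, u}"
      using keys_diff[of 1 "Poly_Mapping.single u (c' * c ^ s)"] by (auto split: if_splits)
    moreover have "(\<Sum>l\<le>n. Poly_Mapping.lookup u l) = 0"
      using assms by (simp add: lu sum_subtractf of_bool_def)
    ultimately show ?thesis
      using assms by (auto simp: balanced_def lu)
  qed
  from balanced_prod[of "{..<r}" n "\<lambda>_ l. of_bool (l = j)", OF this] show ?thesis
    by (simp add: qpoch_def mult.commute)
qed

lemma balanced_Lq:
  "balanced n (\<lambda>l. \<Sum>(i, j) \<in> {(i, j). i < j \<and> j \<le> n}.
     of_bool (l = j) * B i j + of_bool (l = i) * B j i) (Lq n B)"
proof -
  have "balanced n (\<lambda>l. (case s of (i, j) \<Rightarrow> of_bool (l = j) * B i j + of_bool (l = i) * B j i))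
      (case s of (i, j) \<Rightarrow> qpoch (lconst q_ind) (xquot i j) (B i j) *
         qpoch (lconst q_ind) (lconst q_ind * xquot j i) (B j i))"
    if s: "s \<in> {(i, j). i < j \<and> j \<le> n}" for s
  proof -
    obtain i j where ij: "s = (i, j)" "i < j" "j \<le> n" using s by auto
    \<comment> \<open>The first factor of each pair, without the extra q, is the case
      \<open>c' = 1\<close>.\<close>
    have "lconst 1 = 1" by (simp add: lconst_def)
    then show ?thesis
      using balanced_mult[OF balanced_qpoch[of i n j "B i j" q_ind 1] balanced_qpoch[of j n i "B j i" q_ind q_ind]] ij
      by simp
  qed
  from balanced_prod[OF this] show ?thesis
    unfolding Lq_def .
qed

text \<open>
  The polynomial \<open>g\<close> is obtained by applying, in each of \<open>x\<^sub>1, \<dots>, x\<^sub>n\<close>, the divided difference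
  that extracts the coefficient of \<open>x\<^sub>j\<^bsup>d j\<^esup>\<close>. By homogeneity, a monomial that survives and differs
  from the constant one has a negative exponent at \<open>x\<^sub>0\<close>.
\<close>

lemma CT_by_interpolation:
  fixes v :: "nat \<Rightarrow> ratfun"
  assumes bal: "balanced n d L"
    and v: "inj v" "\<And>i. v i \<noteq> 0"
    and E: "\<And>j. j \<in> {1..n} \<Longrightarrow> finite (E j)" "\<And>j. j \<in> {1..n} \<Longrightarrow> card (E j) = Suc (d j)"
  obtains g where "degree g \<le> d 0" "coeff g (d 0) = CT L"
    "\<And>t. t \<noteq> 0 \<Longrightarrow> poly g t = (\<Sum>\<alpha>\<in>PiE {1..n} E.
       (\<Prod>j=1..n. v (\<alpha> j) ^ d j / (\<Prod>l\<in>E j - {\<alpha> j}. v (\<alpha> j) - v l)) *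
       (t ^ d 0 * leval n (\<lambda>i. if i = 0 then t else v (\<alpha> i)) L))"
proof -
  \<comment> \<open>The divided difference over \<open>E j\<close> of the power with exponent
    \<open>d j + e\<close>.\<close>
  define \<Lambda> where "\<Lambda> j e = (\<Sum>s\<in>E j. v s powi (int (d j) + e) / (\<Prod>l\<in>E j - {s}. v s - v l))" for j e
  define lk where "lk = (Poly_Mapping.lookup :: (nat \<Rightarrow>\<^sub>0 int) \<Rightarrow> nat \<Rightarrow> int)"
  \<comment> \<open>Powers of x_1, ..., x_n become divided differences and x_0 stays as the
    variable, multiplied up by its power \<open>d 0\<close>. Balancedness makes the argument of
    \<open>nat\<close> nonnegative.\<close>
  define g where "g = (\<Sum>e\<in>Poly_Mapping.keys L. monom (Poly_Mapping.lookup L e * (\<Prod>j=1..n. \<Lambda> j (lk e j))) (nat (int (d 0) + lk e 0)))"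
  \<comment> \<open>In this range the power has degree at most \<open>d j\<close>, and the divided
    difference detects whether the degree is \<open>d j\<close>. Positive \<open>e\<close> is left
    to the homogeneity argument in \<open>surv\<close>.\<close>
  have \<Lambda>: "\<Lambda> j e = of_bool (e = 0)" if j: "j \<in> {1..n}" and e: "- int (d j) \<le> e" "e \<le> 0" for j e
  proof -
    define r where "r = nat (int (d j) + e)"
    have r: "int (d j) + e = int r" "r \<le> d j" "r = d j \<longleftrightarrow> e = 0" using e by (auto simp: r_def)
    have "\<Lambda> j e = (\<Sum>s\<in>E j. poly (monom 1 r) (v s) / (\<Prod>l\<in>E j - {s}. v s - v l))"
      by (simp add: \<Lambda>_def r poly_monom)
    also have "\<dots> = coeff (monom 1 r) (card (E j) - 1)"
      by (rule sum_Lagrange_eq_coeff)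
        (use j v(1) r E in \<open>auto intro: inj_on_subset simp: degree_monom_eq\<close>)
    finally show ?thesis using E(2)[OF j] r by auto
  qed
  have bal': "(\<Sum>i\<le>n. lk e i) = 0" "i > n \<Longrightarrow> lk e i = 0" "- int (d i) \<le> lk e i"
    if "e \<in> Poly_Mapping.keys L" for e i
    using bal that by (auto simp: balanced_def lk_def)
  have split: "{..n} = insert 0 {1..n}" by auto
  \<comment> \<open>A negative exponent at some x_j with j \<ge> 1 is killed by
    \<open>\<Lambda>\<close>. Otherwise these exponents are nonnegative, and their sum is minus the
    exponent of x_0.\<close>
  have surv: "e = 0 \<or> lk e 0 < 0"
    if e: "e \<in> Poly_Mapping.keys L" and nz: "(\<Prod>j=1..n. \<Lambda> j (lk e j)) \<noteq> 0" for e
  proof -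
    have nn: "lk e j \<ge> 0" if j: "j \<in> {1..n}" for j
    proof (rule ccontr)
      assume neg: "\<not> lk e j \<ge> 0"
      then have "\<Lambda> j (lk e j) = 0" using \<Lambda>[OF j] bal'(3)[OF e, of j] by auto
      with nz j show False by auto
    qed
    have s0: "lk e 0 + (\<Sum>j=1..n. lk e j) = 0"
      using bal'(1)[OF e] by (simp add: split)
    show ?thesis
    proof (cases "(\<Sum>j=1..n. lk e j) = 0")
      case True
      then have z: "\<forall>j\<in>{1..n}. lk e j = 0"
        using nn by (subst (asm) sum_nonneg_eq_0_iff) auto
      have "lk e i = 0" for i
        using z s0 True bal'(2)[OF e, of i] by (cases "i = 0"; cases "i > n") auto
      then show ?thesis by (auto simp: lk_def intro: poly_mapping_eqI)
    next
      case False
      with sum_nonneg[of "{1..n}" "lk e"] nn s0 show ?thesis by fastforce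
    qed
  qed
  show thesis
  proof (rule that)
    have "degree (monom (Poly_Mapping.lookup L e * (\<Prod>j=1..n. \<Lambda> j (lk e j))) (nat (int (d 0) + lk e 0))) \<le> d 0"
      if "e \<in> Poly_Mapping.keys L" for e
    proof (cases "(\<Prod>j=1..n. \<Lambda> j (lk e j)) = 0")
      case False
      with surv[OF that] have "lk e 0 \<le> 0" by (auto simp: lk_def)
      then show ?thesis by (intro order.trans[OF degree_monom_le]) auto
    next
      case True
      show ?thesis unfolding True by simp
    qed
    then show "degree g \<le> d 0" unfolding g_def by (intro degree_sum_le) auto
    have "coeff g (d 0) = (\<Sum>e\<in>Poly_Mapping.keys L. if e = 0 then Poly_Mapping.lookup L e else 0)"
      unfolding g_def coeff_sum
    proof (rule sum.cong[OF refl])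
      fix e assume e: "e \<in> Poly_Mapping.keys L"
      show "coeff (monom (Poly_Mapping.lookup L e * (\<Prod>j=1..n. \<Lambda> j (lk e j))) (nat (int (d 0) + lk e 0))) (d 0) =
          (if e = 0 then Poly_Mapping.lookup L e else 0)"
      proof (cases "e = 0")
        case True
        have "(\<Prod>j=1..n. \<Lambda> j (lk e j)) = 1"
          by (rule prod.neutral) (use True \<Lambda> in \<open>auto simp: lk_def\<close>)
        with True show ?thesis by (simp add: lk_def)
      next
        case False
        with surv[OF e] bal'(3)[OF e, of 0] show ?thesis by auto
      qed
    qed
    also have "\<dots> = CT L"
      by (auto simp: CT_def in_keys_iff)
    finally show "coeff g (d 0) = CT L" .
    fix t :: ratfun assume t: "t \<noteq> 0"
    define M where "M \<alpha> = (\<Prod>j=1..n. v (\<alpha> j) ^ d j / (\<Prod>l\<in>E j - {\<alpha> j}. v (\<alpha> j) - v l))" for \<alpha>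
    have "poly g t = (\<Sum>e\<in>Poly_Mapping.keys L. \<Sum>\<alpha>\<in>PiE {1..n} E. M \<alpha> * (t ^ d 0 *
         (Poly_Mapping.lookup L e * (\<Prod>i\<le>n. (if i = 0 then t else v (\<alpha> i)) powi Poly_Mapping.lookup e i))))"
      unfolding g_def poly_sum
    proof (rule sum.cong[OF refl])
      fix e assume e: "e \<in> Poly_Mapping.keys L"
      have "t ^ nat (int (d 0) + lk e 0) = t powi (int (d 0) + lk e 0)"
        using bal'(3)[OF e, of 0] by (simp add: power_int_nonneg_exp)
      also have "\<dots> = t ^ d 0 * t powi lk e 0" using t by (simp add: power_int_add)
      finally have t': "t ^ nat (int (d 0) + lk e 0) = t ^ d 0 * t powi lk e 0" .
      \<comment> \<open>Expand the product of sums over all choices \<open>\<alpha>\<close> of one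
        grid point per variable.\<close>
      have "(\<Prod>j=1..n. \<Lambda> j (lk e j)) = (\<Sum>\<alpha>\<in>PiE {1..n} E. \<Prod>j=1..n. v (\<alpha> j) powi (int (d j) + lk e j) /
           (\<Prod>l\<in>E j - {\<alpha> j}. v (\<alpha> j) - v l))"
        unfolding \<Lambda>_def by (rule prod_sum_PiE) (use E in auto)
      also have "\<dots> = (\<Sum>\<alpha>\<in>PiE {1..n} E. M \<alpha> * (\<Prod>j=1..n. v (\<alpha> j) powi lk e j))"
        unfolding M_def prod.distrib[symmetric]
        by (intro sum.cong prod.cong) (auto simp: power_int_add v)
      finally have "(\<Prod>j=1..n. \<Lambda> j (lk e j)) = (\<Sum>\<alpha>\<in>PiE {1..n} E. M \<alpha> * (\<Prod>j=1..n. v (\<alpha> j) powi lk e j))" .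
      moreover have "(\<Prod>i\<le>n. (if i = 0 then t else v (\<alpha> i)) powi Poly_Mapping.lookup e i) =
          t powi lk e 0 * (\<Prod>j=1..n. v (\<alpha> j) powi lk e j)" for \<alpha>
        unfolding split by (simp add: lk_def)
      ultimately show "poly (monom (Poly_Mapping.lookup L e * (\<Prod>j=1..n. \<Lambda> j (lk e j))) (nat (int (d 0) + lk e 0))) t =
          (\<Sum>\<alpha>\<in>PiE {1..n} E. M \<alpha> * (t ^ d 0 *
         (Poly_Mapping.lookup L e * (\<Prod>i\<le>n. (if i = 0 then t else v (\<alpha> i)) powi Poly_Mapping.lookup e i))))"
        unfolding poly_monom t' by (simp add: sum_distrib_left sum_distrib_right mult_ac)
    qed
    also have "\<dots> = (\<Sum>\<alpha>\<in>PiE {1..n} E. M \<alpha> * (t ^ d 0 * leval n (\<lambda>i. if i = 0 then t else v (\<alpha> i)) L))"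
      unfolding leval_def sum_distrib_left by (rule sum.swap)
    finally show "poly g t = (\<Sum>\<alpha>\<in>PiE {1..n} E.
       (\<Prod>j=1..n. v (\<alpha> j) ^ d j / (\<Prod>l\<in>E j - {\<alpha> j}. v (\<alpha> j) - v l)) *
       (t ^ d 0 * leval n (\<lambda>i. if i = 0 then t else v (\<alpha> i)) L))"
      unfolding M_def .
  qed
qed

section \<open>Spread exponent vectors\<close>

text \<open>The pair \<open>(\<alpha> j, j)\<close> is coded as the number \<open>f j\<close>, with
  \<open>j\<close> as its last digit in base n + 1; \<open>\<pi>\<close> lists the indices by
  increasing code.\<close>

lemma ex_lex_sorting:
  fixes \<alpha> :: "nat \<Rightarrow> nat"
  obtains \<pi> where "bij_betw \<pi> {..<n} {1..n}"
    "\<And>i. Suc i < n \<Longrightarrow> \<alpha> (\<pi> i) < \<alpha> (\<pi> (Suc i)) \<or> \<alpha> (\<pi> i) = \<alpha> (\<pi> (Suc i)) \<and> \<pi> i < \<pi> (Suc i)"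
proof -
  define f where "f j = \<alpha> j * Suc n + j" for j
  have lex: "\<alpha> i < \<alpha> j \<or> \<alpha> i = \<alpha> j \<and> i < j" if "f i < f j" "i \<le> n" "j \<le> n" for i j
  proof (rule ccontr)
    assume "\<not> ?thesis"
    then consider "\<alpha> j < \<alpha> i" | "\<alpha> i = \<alpha> j" "j \<le> i" by fastforce
    then show False
    proof cases
      case 1
      then have "Suc (\<alpha> j) * Suc n \<le> \<alpha> i * Suc n" by (intro mult_right_mono) auto
      with that show False by (simp add: f_def)
    qed (use that in \<open>simp add: f_def\<close>)
  qed
  have inj: "inj_on f {1..n}"
  proof (rule inj_onI)
    fix i j assume *: "i \<in> {1..n}" "j \<in> {1..n}" "f i = f j"
    have md: "f x mod Suc n = x" if "x \<in> {1..n}" for x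
      using that by (simp add: f_def del: mult_Suc_right)
    have "i = f i mod Suc n" by (rule md[OF *(1), symmetric])
    also have "\<dots> = j" unfolding *(3) by (rule md[OF *(2)])
    finally show "i = j" .
  qed
  then have card: "card (f ` {1..n}) = n" by (simp add: card_image)
  obtain h where h: "bij_betw h {..<n} (f ` {1..n})" "strict_mono_on {..<n} h"
    using ex_bij_betw_strict_mono_card[of "f ` {1..n}"] card by auto
  have bf: "bij_betw (the_inv_into {1..n} f) (f ` {1..n}) {1..n}"
    by (rule bij_betw_the_inv_into[OF inj_on_imp_bij_betw[OF inj]])
  define \<pi> where "\<pi> = the_inv_into {1..n} f \<circ> h"
  have \<pi>: "bij_betw \<pi> {..<n} {1..n}"
    unfolding \<pi>_def by (rule bij_betw_trans[OF h(1) bf])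
  have f\<pi>: "f (\<pi> i) = h i" if "i < n" for i
  proof -
    have "h i \<in> f ` {1..n}" using h(1) that by (auto simp only: bij_betw_def)
    then show ?thesis unfolding \<pi>_def comp_def by (rule f_the_inv_into_f[OF inj])
  qed
  show thesis
  proof (rule that[OF \<pi>])
    fix i assume i: "Suc i < n"
    have "f (\<pi> i) < f (\<pi> (Suc i))"
      using h(2) i by (simp add: f\<pi> strict_mono_on_def)
    moreover have "\<pi> i \<le> n" "\<pi> (Suc i) \<le> n"
      using \<pi> i by (auto simp: bij_betw_def)
    ultimately show "\<alpha> (\<pi> i) < \<alpha> (\<pi> (Suc i)) \<or> \<alpha> (\<pi> i) = \<alpha> (\<pi> (Suc i)) \<and> \<pi> i < \<pi> (Suc i)"
      by (rule lex)
  qed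
qed

text \<open>The numbers c_i of the overview; truncated subtraction supplies the maximum with
  0.\<close>

definition ladder :: "nat \<Rightarrow> nat \<Rightarrow> nat \<Rightarrow> nat" where
  "ladder n0 k i = k * i + (i - n0)"

text \<open>This is what nonvanishing of the pair factors enforces. The gap depends on the smaller
  index only, since for i < j both indices exceed n0 iff i does; strictness in the second case
  reflects the extra q of the second factor.\<close>

definition spread :: "nat \<Rightarrow> nat \<Rightarrow> nat \<Rightarrow> (nat \<Rightarrow> nat) \<Rightarrow> bool" where
  "spread n n0 k \<alpha> \<longleftrightarrow> (\<forall>i j. 1 \<le> i \<longrightarrow> i < j \<longrightarrow> j \<le> n \<longrightarrow>
     (\<alpha> i \<le> \<alpha> j \<longrightarrow> \<alpha> i + (k + of_bool (n0 < i)) \<le> \<alpha> j) \<and>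
     (\<alpha> j < \<alpha> i \<longrightarrow> \<alpha> j + (k + of_bool (n0 < i)) < \<alpha> i))"

lemma card_inj_on_bounded_le:
  fixes \<pi> :: "'a \<Rightarrow> nat"
  assumes "inj_on \<pi> S" "\<And>l. l \<in> S \<Longrightarrow> 1 \<le> \<pi> l"
  shows "card {l \<in> S. \<pi> l \<le> n0} \<le> n0"
proof -
  have "card {l \<in> S. \<pi> l \<le> n0} = card (\<pi> ` {l \<in> S. \<pi> l \<le> n0})"
    by (rule card_image[symmetric]) (use assms(1) in \<open>auto intro: inj_on_subset\<close>)
  also have "\<dots> \<le> card {1..n0}" by (rule card_mono) (use assms(2) in auto)
  finally show ?thesis by simp
qed

text \<open>Each step up the sorted list gains at least k, and one more if it is costly. Few steps
  can be free because only n0 indices are small; this bounds the exponents from below. Descending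
  from the largest exponent, with the deleted grid points filling the one missing unit, bounds them
  from above. If all exponents are at least b, both bounds meet.\<close>

lemma spread_sorted:
  assumes sp: "spread n n0 k \<alpha>" and mn: "n \<le> m + n0" "n0 \<le> n"
    and top: "\<And>j. j \<in> {1..n} \<Longrightarrow> \<alpha> j \<le> b + ladder n0 k (n - 1)"
    and gap: "\<And>j i. j \<in> {1..n0} \<Longrightarrow> n0 \<le> i \<Longrightarrow> Suc i < n \<Longrightarrow> \<alpha> j \<noteq> Suc (b + ladder n0 k i)"
  obtains \<pi> where "bij_betw \<pi> {..<n} {1..n}"
    "\<And>i. i < n \<Longrightarrow> ladder n0 k i \<le> \<alpha> (\<pi> i)"
    "\<And>i. i < n \<Longrightarrow> \<alpha> (\<pi> i) \<le> b + ladder n0 k i"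
    "\<And>i. i < n \<Longrightarrow> n - m \<le> i \<Longrightarrow> \<pi> i \<le> n - m \<Longrightarrow> ladder n0 k i < \<alpha> (\<pi> i)"
    "\<forall>j\<in>{1..n}. b \<le> \<alpha> j \<Longrightarrow> \<forall>j\<in>{1..n}. \<alpha> j = b + ladder n0 k (j - 1)"
proof -
  obtain \<pi> where bij: "bij_betw \<pi> {..<n} {1..n}"
    and srt: "\<And>i. Suc i < n \<Longrightarrow> \<alpha> (\<pi> i) < \<alpha> (\<pi> (Suc i)) \<or> \<alpha> (\<pi> i) = \<alpha> (\<pi> (Suc i)) \<and> \<pi> i < \<pi> (Suc i)"
    using ex_lex_sorting[of n \<alpha>] by blast
  have ran: "\<pi> i \<in> {1..n}" if "i < n" for i
    using bij that by (auto simp: bij_betw_def)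
  have inj: "inj_on \<pi> {..<n}" using bij by (simp add: bij_betw_def)
  have up: "\<alpha> (\<pi> i) + (k + of_bool (n0 < \<pi> i)) \<le> \<alpha> (\<pi> (Suc i))"
    if "Suc i < n" "\<pi> i < \<pi> (Suc i)" for i
    using sp[unfolded spread_def, rule_format, of "\<pi> i" "\<pi> (Suc i)"] srt[of i] that ran[of i] ran[of "Suc i"]
    by auto
  have down: "\<alpha> (\<pi> i) + (k + of_bool (n0 < \<pi> (Suc i))) < \<alpha> (\<pi> (Suc i))"
    if "Suc i < n" "\<pi> (Suc i) < \<pi> i" for i
    using sp[unfolded spread_def, rule_format, of "\<pi> (Suc i)" "\<pi> i"] srt[of i] that ran[of i] ran[of "Suc i"]
    by auto
  have ne: "\<pi> i \<noteq> \<pi> (Suc i)" if "Suc i < n" for i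
    using inj_onD[OF inj, of i "Suc i"] that by auto
  \<comment> \<open>A step gains an extra unit if it starts at an index above n0 or descends in
    index; the latter comes from the strict inequality in \<open>spread\<close>.\<close>
  define cost where "cost i \<longleftrightarrow> n0 < \<pi> i \<or> \<pi> (Suc i) < \<pi> i" for i
  have advance: "\<alpha> (\<pi> i) + k + of_bool (cost i) \<le> \<alpha> (\<pi> (Suc i))" if "Suc i < n" for i
    using up[OF that] down[OF that] ne[OF that] by (cases "\<pi> i < \<pi> (Suc i)") (auto simp: cost_def)
  \<comment> \<open>The common lower bound \<open>lo\<close> is 0 for the general bounds and b for
    the uniqueness claim.\<close>
  have low: "lo + k * i + card {l. l < i \<and> cost l} \<le> \<alpha> (\<pi> i)"
    if "i < n" "\<And>j. j \<in> {1..n} \<Longrightarrow> lo \<le> \<alpha> j" for i lo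
    using that(1)
  proof (induction i)
    case 0
    with that(2) ran[of 0] show ?case by auto
  next
    case (Suc i)
    have "{l. l < Suc i \<and> cost l} = (if cost i then insert i {l. l < i \<and> cost l} else {l. l < i \<and> cost l})"
      by (auto simp: less_Suc_eq)
    then have "card {l. l < Suc i \<and> cost l} = card {l. l < i \<and> cost l} + of_bool (cost i)"
      by auto
    with advance[of i] Suc show ?case by simp
  qed
  have costs: "i \<le> card {l. l < i \<and> cost l} + card {l \<in> {..<i}. \<pi> l \<le> n0}" for i
  proof -
    have "card {..<i} \<le> card ({l. l < i \<and> cost l} \<union> {l \<in> {..<i}. \<pi> l \<le> n0})"
      by (rule card_mono) (auto simp: cost_def)
    also have "\<dots> \<le> card {l. l < i \<and> cost l} + card {l \<in> {..<i}. \<pi> l \<le> n0}" by (rule card_Un_le)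
    finally show ?thesis by simp
  qed
  have smalls: "card {l \<in> {..<i}. \<pi> l \<le> n0} \<le> n0" if "i \<le> n" for i
    by (rule card_inj_on_bounded_le) (use that inj ran in \<open>auto intro: inj_on_subset\<close>)
  have lower: "lo + ladder n0 k i \<le> \<alpha> (\<pi> i)" if "i < n" "\<And>j. j \<in> {1..n} \<Longrightarrow> lo \<le> \<alpha> j" for i lo
    using low[OF that] costs[of i] smalls[of i] that(1) by (auto simp: ladder_def)
  \<comment> \<open>Here \<open>\<pi> i\<close> is at most n0 and occupies one of the small indices,
    so fewer than n0 precede it. This gains a unit when i \<ge> n0; for smaller i a single costly
    step suffices, and without one the indices would ascend past n - m.\<close>
  have lower': "ladder n0 k i < \<alpha> (\<pi> i)" if i: "i < n" "n - m \<le> i" "\<pi> i \<le> n - m" for i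
  proof -
    have small: "\<pi> i \<le> n0" using i mn by auto
    have "{l \<in> {..<Suc i}. \<pi> l \<le> n0} = insert i {l \<in> {..<i}. \<pi> l \<le> n0}" using small by auto
    then have c1: "card {l \<in> {..<i}. \<pi> l \<le> n0} < n0"
      using smalls[of "Suc i"] i by auto
    have "\<exists>l<i. cost l"
    proof (rule ccontr)
      assume "\<not> ?thesis"
      then have asc: "\<pi> l < \<pi> (Suc l)" if "l < i" for l
        using ne[of l] that i by (force simp: cost_def)
      have "l < \<pi> l" if "l \<le> i" for l
        using that
      proof (induction l)
        case 0 then show ?case using ran[of 0] i by auto
      next
        case (Suc l) then show ?case using asc[of l] by auto
      qed
      from this[of i] i show False by auto
    qed
    then have "card {l. l < i \<and> cost l} > 0" by (subst card_gt_0_iff) auto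
    with low[of i 0] costs[of i] c1 i show ?thesis by (auto simp: ladder_def)
  qed
  have upper: "\<alpha> (\<pi> i) \<le> b + ladder n0 k i" if "i < n" for i
  proof -
    have "i \<le> n - 1" using that by simp
    then show ?thesis
    proof (induction i rule: inc_induct)
      case base
      then show ?case using top ran[of "n - 1"] that by auto
    next
      case (step i)
      then have Si: "Suc i < n" by auto
      note st = step.IH and st2 = advance[OF Si]
      show ?case
      \<comment> \<open>The ladder rises by k below n0 and by k + 1 from n0 on, so only a free step
        at i \<ge> n0 falls short, by one. It starts at an index at most n0, for which the offending
        value is deleted from the grid.\<close>
      proof (cases "i < n0 \<or> cost i")
        case True
        with st st2 show ?thesis by (auto simp: ladder_def)
      next
        case False
        then have "\<pi> i \<in> {1..n0}" using ran[of i] Si by (auto simp: cost_def)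
        with gap[of "\<pi> i" i] False Si have "\<alpha> (\<pi> i) \<noteq> Suc (b + ladder n0 k i)" by auto
        with st st2 False show ?thesis by (auto simp: ladder_def Suc_diff_le)
      qed
    qed
  qed
  have uniq: "\<alpha> j = b + ladder n0 k (j - 1)"
    if big: "\<And>j. j \<in> {1..n} \<Longrightarrow> b \<le> \<alpha> j" and j: "j \<in> {1..n}" for j
  proof -
    \<comment> \<open>With all exponents at least b the bounds agree; what remains is to show that
      \<open>\<pi>\<close> is the shift by one.\<close>
    have eq: "\<alpha> (\<pi> i) = b + ladder n0 k i" if "i < n" for i
      using upper[OF that] lower[OF that, of b] big by force
    have nc: "\<not> cost i" if "Suc i < n" "i < n0" for i
      using advance[OF that(1)] eq[of i] eq[of "Suc i"] that by (auto simp: ladder_def)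
    \<comment> \<open>Free steps ascend, which gives the lower bound; the last of them starts at an
      index at most n0, and going down from there gives the upper bound.\<close>
    have id1: "\<pi> i = Suc i" if "i < n" "i < n0" for i
    proof -
      have *: "l < \<pi> l" if "l \<le> i" for l
        using that
      proof (induction l)
        case 0 then show ?case using ran[of 0] \<open>i < n\<close> by auto
      next
        case (Suc l) then show ?case using nc[of l] ne[of l] \<open>i < n\<close> \<open>i < n0\<close> by (force simp: cost_def)
      qed
      have **: "\<pi> l \<le> Suc l" if "l \<le> n0 - 1" for l
        using that
      proof (induction l rule: inc_induct)
        case base
        show ?case
        proof (cases "Suc (n0 - 1) < n")
          case True
          with nc[of "n0 - 1"] \<open>i < n0\<close> show ?thesis by (auto simp: cost_def)
        next
          case False
          with mn \<open>i < n0\<close> have "n0 = n" by auto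
          with ran[of "n0 - 1"] \<open>i < n0\<close> show ?thesis by auto
        qed
      next
        case (step l)
        then show ?case using nc[of l] ne[of l] mn by (force simp: cost_def)
      qed
      have "i \<le> n0 - 1" using that by simp
      from *[of i] **[OF this] show ?thesis by simp
    qed
    \<comment> \<open>The indices up to n0 are already taken by the positions below n0.\<close>
    have bigs: "n0 < \<pi> i" if i: "i < n" "n0 \<le> i" for i
    proof (rule ccontr)
      assume *: "\<not> ?thesis"
      obtain s where s: "\<pi> i = Suc s" using ran[OF i(1)] by (cases "\<pi> i") auto
      have "s < n0" "s < n" using * s ran[OF i(1)] by auto
      then have "\<pi> s = \<pi> i" using id1[of s] s by simp
      then have "s = i" using inj_onD[OF inj, of s i] \<open>s < n\<close> i by simp
      with \<open>s < n0\<close> i show False by simp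
    qed
    have asc: "\<pi> i < \<pi> (Suc i)" if "Suc i < n" for i
    proof (cases "i < n0")
      case True
      with nc[OF that] ne[OF that] show ?thesis by (force simp: cost_def)
    next
      case False
      \<comment> \<open>A descent onto an index above n0 would gain more than k + 1, but the ladder
        rises by exactly k + 1 here.\<close>
      have "\<not> \<pi> (Suc i) < \<pi> i"
      proof
        assume "\<pi> (Suc i) < \<pi> i"
        from down[OF that this] bigs[of "Suc i"] eq[of i] eq[of "Suc i"] that False
        show False by (simp add: ladder_def Suc_diff_le)
      qed
      with ne[OF that] show ?thesis by linarith
    qed
    have id: "\<pi> i = Suc i" if "i < n" for i
    proof (rule antisym)
      show "Suc i \<le> \<pi> i"
        using that
      proof (induction i)
        case 0 then show ?case using ran[of 0] by auto
      next
        case (Suc i) then show ?case using asc[of i] by auto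
      qed
      have "i \<le> n - 1" using that by auto
      then show "\<pi> i \<le> Suc i"
      proof (induction i rule: inc_induct)
        case base
        then show ?case using ran[of "n - 1"] that by auto
      next
        case (step i)
        then have "Suc i < n" by linarith
        from asc[OF this] step show ?case by linarith
      qed
    qed
    obtain l where "j = Suc l" "l < n" using j by (cases j) auto
    with id[of l] eq[of l] show ?thesis by simp
  qed
  show thesis
  proof (rule that)
    show "bij_betw \<pi> {..<n} {1..n}" by (rule bij)
    show "ladder n0 k i \<le> \<alpha> (\<pi> i)" if "i < n" for i using lower[OF that, of 0] by simp
    show "\<alpha> (\<pi> i) \<le> b + ladder n0 k i" if "i < n" for i using that by (rule upper)
    show "ladder n0 k i < \<alpha> (\<pi> i)" if "i < n" "n - m \<le> i" "\<pi> i \<le> n - m" for i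
      using that by (rule lower')
    show "\<forall>j\<in>{1..n}. \<alpha> j = b + ladder n0 k (j - 1)" if "\<forall>j\<in>{1..n}. b \<le> \<alpha> j"
      using uniq that by blast
  qed
qed

section \<open>The interpolation grid\<close>

lemma ladder_0 [simp]: "ladder n0 k 0 = 0"
  by (simp add: ladder_def)

lemma ladder_Suc: "ladder n0 k (Suc i) = ladder n0 k i + (k + of_bool (n0 \<le> i))"
  by (auto simp: ladder_def Suc_diff_le)

lemma ladder_mono: "i \<le> j \<Longrightarrow> ladder n0 k i \<le> ladder n0 k j"
  by (auto simp: ladder_def intro!: add_mono)

lemma ladder_strict: "i < j \<Longrightarrow> n0 < j \<Longrightarrow> ladder n0 k i < ladder n0 k j"
  unfolding ladder_def by (rule add_le_less_mono) auto

section \<open>Powers of q, q-factorials and telescoping\<close>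

lemma q_ind_nonzero [simp]: "q_ind \<noteq> 0"
  using one_minus_q_power_nonzero[of 1] by (simp add: q_ind_def Zero_fract_def eq_fract)

lemma q_ind_power_eq_iff: "q_ind ^ i = q_ind ^ j \<longleftrightarrow> i = j"
proof -
  have *: "i = j" if "i \<le> j" "q_ind ^ i = q_ind ^ j" for i j
  proof (rule ccontr)
    assume "i \<noteq> j"
    have "q_ind ^ j = q_ind ^ i * q_ind ^ (j - i)" using that power_add[of q_ind i "j - i"] by simp
    with that have "1 - q_ind ^ (j - i) = 0" by simp
    with one_minus_q_power_nonzero[of "j - i"] \<open>i \<noteq> j\<close> that show False by auto
  qed
  show ?thesis using *[of i j] *[of j i] by (cases "i \<le> j") auto
qed

lemma qfact_Suc: "qfact (Suc N) = qfact N * (1 - q_ind ^ Suc N)"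
  by (simp add: qpoch_def)

lemma qfact_0 [simp]: "qfact 0 = 1"
  by (simp add: qpoch_def)

lemma prod_one_minus_q_power: "(\<Prod>u=1..N. 1 - q_ind ^ u) = qfact N"
  by (simp add: qpoch_def prod.atLeast1_atMost_eq)

lemma qfact_add: "qfact (N + r) = qfact N * (\<Prod>s<r. 1 - q_ind ^ (N + Suc s))"
  by (induction r) (simp_all add: qfact_Suc)

lemma prod_lessThan_add:
  fixes f :: "nat \<Rightarrow> 'a::comm_monoid_mult"
  shows "(\<Prod>i<m + r. f i) = (\<Prod>i<m. f i) * (\<Prod>s<r. f (m + s))"
  by (induction r) (simp_all add: mult.assoc)

text \<open>The range is cut at the ladder points. The first b values will match the factor with
  x_0, and the block after c_i the pair of x_(i+1) with x_(j+1).\<close>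

lemma prod_lessThan_ladder:
  fixes f :: "nat \<Rightarrow> 'a::comm_monoid_mult"
  shows "(\<Prod>\<gamma><b + ladder n0 k j. f \<gamma>) =
    (\<Prod>s<b. f s) * (\<Prod>i<j. \<Prod>s<k + of_bool (n0 \<le> i). f (b + ladder n0 k i + s))"
proof (induction j)
  case (Suc j)
  have "(\<Prod>\<gamma><b + ladder n0 k (Suc j). f \<gamma>) = (\<Prod>\<gamma><b + ladder n0 k j. f \<gamma>) *
      (\<Prod>s<k + of_bool (n0 \<le> j). f (b + ladder n0 k j + s))"
    using prod_lessThan_add[of f "b + ladder n0 k j" "k + of_bool (n0 \<le> j)"]
    by (simp only: ladder_Suc add.assoc)
  then show ?case by (simp only: Suc prod.lessThan_Suc mult.assoc)
qed simp

lemma prod_telescope_up: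
  fixes f :: "nat \<Rightarrow> 'a::field"
  assumes "i \<le> j" "\<And>l. l \<in> {i..j} \<Longrightarrow> f l \<noteq> 0"
  shows "(\<Prod>l=i..<j. f (Suc l) / f l) = f j / f i"
  using assms by (induction j rule: dec_induct) simp_all

lemma prod_telescope_down:
  fixes f :: "nat \<Rightarrow> 'a::field"
  assumes "i \<le> j" "\<And>l. l \<in> {i..j} \<Longrightarrow> f l \<noteq> 0"
  shows "(\<Prod>l=i..<j. f l / f (Suc l)) = f i / f j"
  using assms by (induction j rule: dec_induct) simp_all

text \<open>For l < n0 the ladder rises by k and the quotients telescope. From n0 on it rises by k +
  1, and each step leaves one factor, collected in the denominator.\<close>

lemma prod_qfact_ladder:
  assumes "j \<le> N" "e \<le> ladder n0 k j" "j \<le> n0"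
  shows "(\<Prod>l=j..<N. qfact (ladder n0 k l - e + k) / qfact (ladder n0 k l - e)) =
    qfact (ladder n0 k N - e) /
      (qfact (ladder n0 k j - e) * (\<Prod>l=n0..<N. 1 - q_ind ^ (ladder n0 k (Suc l) - e)))"
  using assms(1)
proof (induction N rule: dec_induct)
  case base
  then show ?case using assms by (simp add: qfact_nonzero)
next
  case (step N)
  have e: "e \<le> ladder n0 k N" using assms(2) ladder_mono[OF step(1)] by (rule le_trans)
  show ?case
  proof (cases "N < n0")
    case True
    then have "ladder n0 k N - e + k = ladder n0 k (Suc N) - e" using e by (simp add: ladder_Suc)
    with True step show ?thesis by (simp add: qfact_nonzero)
  next
    case False
    then have "Suc (ladder n0 k N - e + k) = ladder n0 k (Suc N) - e" using e by (simp add: ladder_Suc)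
    then have "qfact (ladder n0 k (Suc N) - e) =
        qfact (ladder n0 k N - e + k) * (1 - q_ind ^ (ladder n0 k (Suc N) - e))"
      by (metis qfact_Suc)
    moreover have "1 - q_ind ^ (ladder n0 k (Suc N) - e) \<noteq> 0"
      using \<open>Suc _ = _\<close> by (intro one_minus_q_power_nonzero) linarith
    ultimately show ?thesis using False step by (simp add: qfact_nonzero)
  qed
qed

text \<open>
  Here \<open>j\<close> stands for the variable \<open>x\<^bsub>j+1\<^esub>\<close>. The points deleted for \<open>j < n\<^sub>0\<close> reduce the grid to the size
  forced by the exponent to be extracted; they are chosen such that a variable of index at most
  \<open>n\<^sub>0\<close> in sorted position \<open>i \<ge> n\<^sub>0\<close> cannot exceed the bound \<open>b + c\<^sub>i\<close>.
\<close>

definition grid :: "nat \<Rightarrow> nat \<Rightarrow> nat \<Rightarrow> nat \<Rightarrow> nat \<Rightarrow> nat set" where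
  "grid n n0 k b j = {..b + ladder n0 k (n - 1)} -
     (if n0 \<le> j then {} else (\<lambda>i. Suc (b + ladder n0 k i)) ` {n0..<n - 1})"

text \<open>From n0 on the steps are at least 1, even for k = 0.\<close>

lemma inj_on_ladder: "inj_on (ladder n0 k) {n0..}"
proof (rule inj_onI)
  fix i j assume "i \<in> {n0..}" "j \<in> {n0..}" "ladder n0 k i = ladder n0 k j"
  with ladder_strict[of i j n0 k] ladder_strict[of j i n0 k] show "i = j"
    by (cases i j rule: linorder_cases) auto
qed

lemma card_grid:
  assumes "j < n"
  shows "card (grid n n0 k b j) = Suc (b + k * (n - 1) + (if n0 \<le> j then n - 1 - n0 else 0))"
proof (cases "n0 \<le> j")
  case True
  then show ?thesis by (simp add: grid_def ladder_def)
next
  case False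
  have sub: "(\<lambda>i. Suc (b + ladder n0 k i)) ` {n0..<n - 1} \<subseteq> {..b + ladder n0 k (n - 1)}"
    using ladder_strict[of _ "n - 1" n0 k] by fastforce
  have "card ((\<lambda>i. Suc (b + ladder n0 k i)) ` {n0..<n - 1}) = n - 1 - n0"
    using inj_on_ladder by (subst card_image) (auto simp: inj_on_def)
  with False sub show ?thesis
    by (simp add: grid_def card_Diff_subset ladder_def)
qed

text \<open>Points are deleted only for j < n0, and then at ladder points with i \<ge> n0; hence all
  deletions lie above \<open>b + ladder n0 k j\<close>, and the part below is a full
  interval.\<close>

lemma grid_above:
  fixes n0 k :: nat
  assumes "j < n"
  defines "N \<equiv> ladder n0 k (n - 1) - ladder n0 k j"
  shows "grid n n0 k b j - {b + ladder n0 k j} = {..<b + ladder n0 k j} \<union>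
    (\<lambda>u. b + ladder n0 k j + u) ` ({1..N} -
      (if n0 \<le> j then {} else (\<lambda>i. Suc (ladder n0 k i - ladder n0 k j)) ` {n0..<n - 1}))" (is "?A = ?B")
proof -
  have jn: "ladder n0 k j \<le> ladder n0 k (n - 1)" using assms by (intro ladder_mono) auto
  have ji: "ladder n0 k j \<le> ladder n0 k i" if "\<not> n0 \<le> j" "n0 \<le> i" for i
    using that by (intro ladder_mono) auto
  show ?thesis
  proof (intro equalityI subsetI)
    fix \<gamma> assume \<gamma>: "\<gamma> \<in> ?A"
    show "\<gamma> \<in> ?B"
    proof (cases "\<gamma> < b + ladder n0 k j")
      case False
      define u where "u = \<gamma> - (b + ladder n0 k j)"
      have g: "\<gamma> = b + ladder n0 k j + u" using False by (simp add: u_def)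
      have "u \<in> {1..N}" using \<gamma> jn by (auto simp: g grid_def N_def)
      moreover have "u \<notin> (\<lambda>i. Suc (ladder n0 k i - ladder n0 k j)) ` {n0..<n - 1}" if "\<not> n0 \<le> j"
      proof
        assume "u \<in> (\<lambda>i. Suc (ladder n0 k i - ladder n0 k j)) ` {n0..<n - 1}"
        then obtain i where i: "i \<in> {n0..<n - 1}" "u = Suc (ladder n0 k i - ladder n0 k j)" by blast
        then have "\<gamma> = Suc (b + ladder n0 k i)" using ji[of i] that by (simp add: g)
        with \<gamma> that i show False by (auto simp: grid_def)
      qed
      ultimately have "u \<in> {1..N} -
          (if n0 \<le> j then {} else (\<lambda>i. Suc (ladder n0 k i - ladder n0 k j)) ` {n0..<n - 1})"
        by auto
      with g show ?thesis by blast
    qed simp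
  next
    fix \<gamma> assume \<gamma>: "\<gamma> \<in> ?B"
    have gap: "\<gamma> \<noteq> Suc (b + ladder n0 k i)" if "\<not> n0 \<le> j" "i \<in> {n0..<n - 1}" for i
    proof
      assume *: "\<gamma> = Suc (b + ladder n0 k i)"
      with ji[of i] that have "\<not> \<gamma> < b + ladder n0 k j" by auto
      with \<gamma> that(1) obtain u where "\<gamma> = b + ladder n0 k j + u"
        "u \<notin> (\<lambda>i. Suc (ladder n0 k i - ladder n0 k j)) ` {n0..<n - 1}" by auto
      moreover from this * ji[of i] that have "u = Suc (ladder n0 k i - ladder n0 k j)" by auto
      ultimately show False using that by auto
    qed
    have "\<gamma> \<notin> (\<lambda>i. Suc (b + ladder n0 k i)) ` {n0..<n - 1}" if "\<not> n0 \<le> j"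
      using gap[OF that] by fastforce
    moreover have "\<gamma> \<le> b + ladder n0 k (n - 1)" "\<gamma> \<noteq> b + ladder n0 k j"
      using \<gamma> jn by (auto simp: N_def)
    ultimately show "\<gamma> \<in> ?A" by (simp add: grid_def)
  qed
qed

text \<open>Each point above contributes X (1 - q^u); multiplying by the factors of the deleted
  points completes the product over u to a q-factorial. The exponent of X counts the points
  above.\<close>

lemma prod_grid:
  fixes n0 k b :: nat
  assumes j: "j < n"
  defines "X \<equiv> q_ind ^ (b + ladder n0 k j)" and "\<delta> \<equiv> k + of_bool (n0 \<le> j)"
    and "N \<equiv> ladder n0 k (n - 1) - ladder n0 k j"
  shows "(\<Prod>\<gamma>\<in>grid n n0 k b j - {b + ladder n0 k j}. X - q_ind ^ \<gamma>) *
      (\<Prod>i\<in>(if n0 \<le> j then {} else {n0..<n - 1}). 1 - q_ind ^ Suc (ladder n0 k i - ladder n0 k j)) =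
    (\<Prod>\<gamma><b + ladder n0 k j. X - q_ind ^ \<gamma>) * X ^ ((n - 1 - j) * \<delta>) * qfact N"
proof -
  let ?G = "if n0 \<le> j then {} else {n0..<n - 1}"
  let ?h = "\<lambda>i. Suc (ladder n0 k i - ladder n0 k j)"
  have ji: "ladder n0 k j \<le> ladder n0 k i" if "\<not> n0 \<le> j" "n0 \<le> i" for i
    using that by (intro ladder_mono) auto
  have jn: "ladder n0 k j \<le> ladder n0 k (n - 1)" using j by (intro ladder_mono) auto
  have inj: "inj_on ?h ?G"
  proof (rule inj_onI)
    fix x y assume *: "x \<in> ?G" "y \<in> ?G" "?h x = ?h y"
    then have "ladder n0 k x = ladder n0 k y" using ji[of x] ji[of y] by (auto split: if_splits)
    with inj_on_ladder[of n0 k] * show "x = y" by (auto simp: inj_on_def split: if_splits)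
  qed
  have sub: "?h ` ?G \<subseteq> {1..N}"
  proof
    fix u assume "u \<in> ?h ` ?G"
    then obtain i where i: "u = ?h i" "n0 \<le> i" "i < n - 1" "\<not> n0 \<le> j" by (auto split: if_splits)
    from ladder_strict[of i "n - 1" n0 k] ji[of i] i show "u \<in> {1..N}" by (auto simp: N_def)
  qed
  have grd: "grid n n0 k b j - {b + ladder n0 k j} = {..<b + ladder n0 k j} \<union>
      (\<lambda>u. b + ladder n0 k j + u) ` ({1..N} - ?h ` ?G)"
    using grid_above[OF j, of n0 k b] by (auto simp: N_def)
  have "(\<Prod>\<gamma>\<in>grid n n0 k b j - {b + ladder n0 k j}. X - q_ind ^ \<gamma>) =
      (\<Prod>\<gamma><b + ladder n0 k j. X - q_ind ^ \<gamma>) *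
      (\<Prod>\<gamma>\<in>(\<lambda>u. b + ladder n0 k j + u) ` ({1..N} - ?h ` ?G). X - q_ind ^ \<gamma>)"
    unfolding grd by (rule prod.union_disjoint) auto
  also have "(\<Prod>\<gamma>\<in>(\<lambda>u. b + ladder n0 k j + u) ` ({1..N} - ?h ` ?G). X - q_ind ^ \<gamma>) =
      (\<Prod>u\<in>{1..N} - ?h ` ?G. X * (1 - q_ind ^ u))"
    by (subst prod.reindex) (auto simp: X_def power_add algebra_simps)
  also have "\<dots> = X ^ card ({1..N} - ?h ` ?G) * (\<Prod>u\<in>{1..N} - ?h ` ?G. 1 - q_ind ^ u)"
    by (simp add: prod.distrib)
  also have "card ({1..N} - ?h ` ?G) = (n - 1 - j) * \<delta>"
  proof -
    have "card ({1..N} - ?h ` ?G) = N - card ?G"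
      using sub inj by (subst card_Diff_subset) (auto simp: card_image finite_subset)
    also have "\<dots> = (n - 1 - j) * \<delta>"
    proof -
      obtain d where d: "n = Suc (j + d)" using j less_imp_Suc_add by blast
      have "N = k * d + (j + d - n0 - (j - n0))"
        by (auto simp: N_def d ladder_def distrib_left)
      then show ?thesis by (auto simp: d \<delta>_def algebra_simps)
    qed
    finally show ?thesis .
  qed
  finally have 1: "(\<Prod>\<gamma>\<in>grid n n0 k b j - {b + ladder n0 k j}. X - q_ind ^ \<gamma>) =
      (\<Prod>\<gamma><b + ladder n0 k j. X - q_ind ^ \<gamma>) *
      (X ^ ((n - 1 - j) * \<delta>) * (\<Prod>u\<in>{1..N} - ?h ` ?G. 1 - q_ind ^ u))" .
  have "(\<Prod>i\<in>?G. 1 - q_ind ^ ?h i) = (\<Prod>u\<in>?h ` ?G. 1 - q_ind ^ u)"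
    using inj by (simp only: prod.reindex comp_def)
  moreover have "(\<Prod>u\<in>{1..N} - ?h ` ?G. 1 - q_ind ^ u) * (\<Prod>u\<in>?h ` ?G. 1 - q_ind ^ u) = qfact N"
    unfolding prod_one_minus_q_power[symmetric]
    by (rule prod.subset_diff[symmetric]) (use sub in auto)
  ultimately show ?thesis unfolding 1 by (simp only: mult.assoc)
qed


text \<open>The numerator counterpart of \<open>prod_grid\<close>: the same power of X comes out
  when \<open>\<delta>\<close> is the step used there, so the two cancel.\<close>

lemma prod_above_ladder:
  fixes n0 k b \<delta> :: nat
  assumes j: "j < n"
  defines "X \<equiv> q_ind ^ (b + ladder n0 k j)"
  shows "(\<Prod>l=Suc j..<n. \<Prod>s<\<delta>. X - q_ind ^ Suc s * q_ind ^ (b + ladder n0 k l)) =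
    X ^ ((n - 1 - j) * \<delta>) *
      (\<Prod>l=Suc j..<n. qfact (ladder n0 k l - ladder n0 k j + \<delta>) / qfact (ladder n0 k l - ladder n0 k j))"
proof -
  have "(\<Prod>l=Suc j..<n. \<Prod>s<\<delta>. X - q_ind ^ Suc s * q_ind ^ (b + ladder n0 k l)) =
      (\<Prod>l=Suc j..<n. X ^ \<delta> * (qfact (ladder n0 k l - ladder n0 k j + \<delta>) / qfact (ladder n0 k l - ladder n0 k j)))"
  proof (rule prod.cong[OF refl])
    fix l assume l: "l \<in> {Suc j..<n}"
    define e where "e = ladder n0 k l - ladder n0 k j"
    have e: "ladder n0 k l = ladder n0 k j + e"
      using ladder_mono[of j l n0 k] l by (simp add: e_def)
    have "(\<Prod>s<\<delta>. X - q_ind ^ Suc s * q_ind ^ (b + ladder n0 k l)) = (\<Prod>s<\<delta>. X * (1 - q_ind ^ (e + Suc s)))"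
      by (rule prod.cong) (simp_all add: X_def e power_add algebra_simps)
    also have "\<dots> = X ^ \<delta> * (\<Prod>s<\<delta>. 1 - q_ind ^ (e + Suc s))"
      by (simp add: prod.distrib)
    also have "(\<Prod>s<\<delta>. 1 - q_ind ^ (e + Suc s)) = qfact (e + \<delta>) / qfact e"
      by (simp add: qfact_add qfact_nonzero)
    finally show "(\<Prod>s<\<delta>. X - q_ind ^ Suc s * q_ind ^ (b + ladder n0 k l)) =
        X ^ \<delta> * (qfact (ladder n0 k l - ladder n0 k j + \<delta>) / qfact (ladder n0 k l - ladder n0 k j))"
      by (simp add: e_def)
  qed
  also have "\<dots> = X ^ ((n - 1 - j) * \<delta>) *
      (\<Prod>l=Suc j..<n. qfact (ladder n0 k l - ladder n0 k j + \<delta>) / qfact (ladder n0 k l - ladder n0 k j))"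
    by (simp only: prod.distrib prod_constant card_atLeastLessThan)
      (simp add: power_mult[symmetric] mult.commute)
  finally show ?thesis .
qed

text \<open>The share of x_(j+1) in the only summand left at t = 1. The first product collects its
  factor with x_0 and those with earlier variables, the second its factors with later ones; the
  denominator is that of the divided difference.\<close>

definition grid_ratio :: "nat \<Rightarrow> nat \<Rightarrow> nat \<Rightarrow> nat \<Rightarrow> nat \<Rightarrow> ratfun" where
  "grid_ratio n n0 k b j =
     (\<Prod>\<gamma><b + ladder n0 k j. q_ind ^ (b + ladder n0 k j) - q_ind ^ \<gamma>) *
     (\<Prod>l=Suc j..<n. \<Prod>s<k + of_bool (n0 \<le> j).
        q_ind ^ (b + ladder n0 k j) - q_ind ^ Suc s * q_ind ^ (b + ladder n0 k l)) /
     (\<Prod>\<gamma>\<in>grid n n0 k b j - {b + ladder n0 k j}. q_ind ^ (b + ladder n0 k j) - q_ind ^ \<gamma>)"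

text \<open>The points below and the powers of X cancel, and with them the dependence on b.\<close>

lemma grid_ratio_eq:
  assumes j: "j < n"
  shows "grid_ratio n n0 k b j =
    (\<Prod>l=Suc j..<n. qfact (ladder n0 k l - ladder n0 k j + (k + of_bool (n0 \<le> j))) /
       qfact (ladder n0 k l - ladder n0 k j)) *
    (\<Prod>i\<in>(if n0 \<le> j then {} else {n0..<n - 1}). 1 - q_ind ^ Suc (ladder n0 k i - ladder n0 k j)) /
    qfact (ladder n0 k (n - 1) - ladder n0 k j)"
proof -
  define X where "X = q_ind ^ (b + ladder n0 k j)"
  define P where "P = (\<Prod>\<gamma><b + ladder n0 k j. X - q_ind ^ \<gamma>)"
  define D where "D = (\<Prod>\<gamma>\<in>grid n n0 k b j - {b + ladder n0 k j}. X - q_ind ^ \<gamma>)"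
  define G where "G = (\<Prod>i\<in>(if n0 \<le> j then {} else {n0..<n - 1}). 1 - q_ind ^ Suc (ladder n0 k i - ladder n0 k j))"
  define V where "V = (\<Prod>l=Suc j..<n. qfact (ladder n0 k l - ladder n0 k j + (k + of_bool (n0 \<le> j))) /
       qfact (ladder n0 k l - ladder n0 k j))"
  define Y where "Y = X ^ ((n - 1 - j) * (k + of_bool (n0 \<le> j)))"
  have nz: "P \<noteq> 0" "Y \<noteq> 0" "G \<noteq> 0"
    using one_minus_q_power_nonzero[of "Suc _"]
    by (auto simp: P_def X_def Y_def G_def q_ind_power_eq_iff split: if_splits)
  have "D * G = P * Y * qfact (ladder n0 k (n - 1) - ladder n0 k j)"
    unfolding D_def G_def P_def Y_def X_def by (rule prod_grid[OF j])
  then have D: "D = P * Y * qfact (ladder n0 k (n - 1) - ladder n0 k j) / G"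
    using nz by (simp add: field_simps)
  have "grid_ratio n n0 k b j = P * (Y * V) / D"
    unfolding grid_ratio_def prod_above_ladder[OF j] by (simp only: D_def P_def X_def Y_def V_def)
  also have "\<dots> = V * G / qfact (ladder n0 k (n - 1) - ladder n0 k j)"
    unfolding D using nz by (simp add: qfact_nonzero)
  finally show ?thesis unfolding V_def G_def .
qed

lemma grid_ratio_small:
  fixes k :: nat
  assumes j: "j < n0" "n0 \<le> n"
  defines "c \<equiv> ladder n0 k"
  shows "grid_ratio n n0 k b j = qfact (c n - c j) / qfact (c n - c (Suc j)) / qfact k *
    (\<Prod>l=n0..<n. (1 - q_ind ^ (c (Suc l) - c (Suc j))) / (1 - q_ind ^ (c (Suc l) - c j)))"
proof -
  have cj: "c (Suc j) = c j + k" using j by (simp add: c_def ladder_Suc)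
  have cl: "c (Suc l) = Suc (c l + k)" "c j \<le> c l" if "n0 \<le> l" for l
    using that j ladder_mono[of j l n0 k] by (simp_all add: c_def ladder_Suc)
  have V: "(\<Prod>l=Suc j..<n. qfact (c l - c j + k) / qfact (c l - c j)) =
      qfact (c n - c j) / (qfact k * (\<Prod>l=n0..<n. 1 - q_ind ^ (c (Suc l) - c j)))"
    using prod_qfact_ladder[of "Suc j" n "c j" n0 k] j cj by (simp add: c_def)
  \<comment> \<open>The deletions stop at n - 2. Supplying the factor for n - 1 above and below
    makes the range uniform; for n0 = n both products are empty.\<close>
  have G: "(\<Prod>i=n0..<n - 1. 1 - q_ind ^ Suc (c i - c j)) / qfact (c (n - 1) - c j) =
      (\<Prod>l=n0..<n. 1 - q_ind ^ (c (Suc l) - c (Suc j))) / qfact (c n - c (Suc j))"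
  proof (cases "n0 = n")
    case True
    obtain N where "n = Suc N" using j by (cases n) auto
    then have "c n = c (n - 1) + k" using True by (simp add: c_def ladder_Suc)
    with True show ?thesis by (simp add: cj)
  next
    case False
    define N where "N = n - 1"
    have n: "n = Suc N" "n0 \<le> N" using False j by (auto simp: N_def)
    have "1 - q_ind ^ (c (Suc l) - c (Suc j)) = 1 - q_ind ^ Suc (c l - c j)" if "n0 \<le> l" for l
      using cl[OF that] by (simp add: cj Suc_diff_le)
    then have "(\<Prod>l=n0..<n. 1 - q_ind ^ (c (Suc l) - c (Suc j))) = (\<Prod>l=n0..<n. 1 - q_ind ^ Suc (c l - c j))"
      by (intro prod.cong) auto
    also have "\<dots> = (\<Prod>l=n0..<N. 1 - q_ind ^ Suc (c l - c j)) * (1 - q_ind ^ Suc (c N - c j))"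
      using n by simp
    finally have 1: "(\<Prod>l=n0..<n. 1 - q_ind ^ (c (Suc l) - c (Suc j))) =
      (\<Prod>l=n0..<N. 1 - q_ind ^ Suc (c l - c j)) * (1 - q_ind ^ Suc (c N - c j))" .
    have "c n - c (Suc j) = Suc (c N - c j)" using cl[OF n(2)] n by (simp add: cj Suc_diff_le)
    then have 2: "qfact (c n - c (Suc j)) = qfact (c N - c j) * (1 - q_ind ^ Suc (c N - c j))"
      by (simp only: qfact_Suc)
    show ?thesis
      unfolding 1 2 N_def[symmetric] using one_minus_q_power_nonzero[of "Suc (c N - c j)"] by simp
  qed
  have "grid_ratio n n0 k b j = (\<Prod>l=Suc j..<n. qfact (c l - c j + k) / qfact (c l - c j)) *
      ((\<Prod>i=n0..<n - 1. 1 - q_ind ^ Suc (c i - c j)) / qfact (c (n - 1) - c j))"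
    using j by (subst grid_ratio_eq) (simp_all add: c_def)
  then show ?thesis unfolding V G by (simp add: prod_dividef)
qed

text \<open>Nothing is deleted, and all steps from j on equal k + 1, so the quotients
  telescope.\<close>

lemma grid_ratio_big:
  fixes k :: nat
  assumes j: "n0 \<le> j" "j < n"
  defines "c \<equiv> ladder n0 k"
  shows "grid_ratio n n0 k b j = qfact (c n - c j) / qfact (c n - c (Suc j)) / qfact (k + 1)"
proof -
  have cl: "c (Suc l) = c l + (k + 1)" if "j \<le> l" for l
    using that j by (simp add: c_def ladder_Suc)
  have cm: "c j \<le> c l" if "j \<le> l" for l using that by (simp add: c_def ladder_mono)
  have "c l - c j + (k + 1) = c (Suc l) - c j" if "j \<le> l" for l
    using cl[OF that] cm[OF that] by linarith
  then have "(\<Prod>l=Suc j..<n. qfact (c l - c j + (k + 1)) / qfact (c l - c j)) =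
      (\<Prod>l=Suc j..<n. qfact (c (Suc l) - c j) / qfact (c l - c j))"
    by (intro prod.cong) auto
  also have "\<dots> = qfact (c n - c j) / qfact (c (Suc j) - c j)"
    using j by (intro prod_telescope_up) (auto simp: qfact_nonzero)
  finally have "(\<Prod>l=Suc j..<n. qfact (c l - c j + (k + 1)) / qfact (c l - c j)) =
      qfact (c n - c j) / qfact (k + 1)"
    using cl[of j] by simp
  moreover have "c (n - 1) - c j = c n - c (Suc j)"
    using cl[of j] cl[of "n - 1"] j by simp
  ultimately show ?thesis
    using j by (subst grid_ratio_eq) (simp_all add: c_def)
qed

text \<open>Over j < n0 both the q-factorials and, for each fixed l, the linear factors telescope,
  leaving Z / W. Over j \<ge> n0 only q-factorials remain. W reappears on the right through
  \<open>prod_qfact_ladder\<close>, and Z is the numerator of the last product.\<close>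

lemma prod_grid_ratio:
  assumes n0: "n0 \<le> n"
  shows "(\<Prod>j<n. grid_ratio n n0 k b j) =
    (\<Prod>j<n. qfact (ladder n0 k j + k) / (qfact (ladder n0 k j) * qfact k)) *
    (\<Prod>j=1..n - n0. (1 - q_ind ^ ((k + 1) * j)) / (1 - q_ind ^ (k + 1)))"
proof -
  define c where "c = ladder n0 k"
  define W where "W = (\<Prod>l=n0..<n. 1 - q_ind ^ (c (Suc l)))"
  define Z where "Z = (\<Prod>l=n0..<n. 1 - q_ind ^ (c (Suc l) - c n0))"
  have split: "(\<Prod>j<n. f j) = (\<Prod>j=0..<n0. f j) * (\<Prod>j=n0..<n. f j)" for f :: "nat \<Rightarrow> ratfun"
    using prod.atLeastLessThan_concat[of 0 n0 n f] n0 by (simp add: atLeast0LessThan)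
  have lt: "c j < c (Suc l)" if "j \<le> n0" "n0 \<le> l" for j l
    using ladder_strict[of j "Suc l" n0 k] that by (simp add: c_def)
  have "(\<Prod>j=0..<n0. grid_ratio n n0 k b j) =
      (\<Prod>j=0..<n0. qfact (c n - c j) / qfact (c n - c (Suc j)) / qfact k *
        (\<Prod>l=n0..<n. (1 - q_ind ^ (c (Suc l) - c (Suc j))) / (1 - q_ind ^ (c (Suc l) - c j))))"
    using grid_ratio_small n0 by (intro prod.cong) (simp_all add: c_def)
  also have "\<dots> = (\<Prod>j=0..<n0. qfact (c n - c j) / qfact (c n - c (Suc j))) / qfact k ^ n0 *
      (\<Prod>l=n0..<n. \<Prod>j=0..<n0. (1 - q_ind ^ (c (Suc l) - c (Suc j))) / (1 - q_ind ^ (c (Suc l) - c j)))"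
    unfolding prod.distrib prod.swap[of _ "{n0..<n}" "{0..<n0}"] by (simp add: prod_dividef prod.distrib)
  also have "(\<Prod>j=0..<n0. qfact (c n - c j) / qfact (c n - c (Suc j))) = qfact (c n) / qfact (c n - c n0)"
    by (subst prod_telescope_down) (auto simp: qfact_nonzero c_def)
  also have "(\<Prod>l=n0..<n. \<Prod>j=0..<n0. (1 - q_ind ^ (c (Suc l) - c (Suc j))) / (1 - q_ind ^ (c (Suc l) - c j))) =
      (\<Prod>l=n0..<n. (1 - q_ind ^ (c (Suc l) - c n0)) / (1 - q_ind ^ c (Suc l)))"
  proof (rule prod.cong[OF refl])
    fix l assume l: "l \<in> {n0..<n}"
    have "1 - q_ind ^ (c (Suc l) - c j) \<noteq> 0" if "j \<le> n0" for j
      using lt[OF that, of l] l by (intro one_minus_q_power_nonzero) auto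
    then show "(\<Prod>j=0..<n0. (1 - q_ind ^ (c (Suc l) - c (Suc j))) / (1 - q_ind ^ (c (Suc l) - c j))) =
        (1 - q_ind ^ (c (Suc l) - c n0)) / (1 - q_ind ^ c (Suc l))"
      by (subst prod_telescope_up[where f = "\<lambda>j. 1 - q_ind ^ (c (Suc l) - c j)"]) (auto simp: c_def)
  qed
  also have "\<dots> = Z / W" by (simp add: Z_def W_def prod_dividef)
  finally have small: "(\<Prod>j=0..<n0. grid_ratio n n0 k b j) =
      qfact (c n) / qfact (c n - c n0) / qfact k ^ n0 * (Z / W)" .
  have "(\<Prod>j=n0..<n. grid_ratio n n0 k b j) =
      (\<Prod>j=n0..<n. qfact (c n - c j) / qfact (c n - c (Suc j)) / qfact (k + 1))"
    using grid_ratio_big by (intro prod.cong) (simp_all add: c_def)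
  also have "\<dots> = (\<Prod>j=n0..<n. qfact (c n - c j) / qfact (c n - c (Suc j))) / qfact (k + 1) ^ (n - n0)"
    by (simp add: prod_dividef prod.distrib)
  also have "(\<Prod>j=n0..<n. qfact (c n - c j) / qfact (c n - c (Suc j))) = qfact (c n - c n0)"
    using n0 by (subst prod_telescope_down) (auto simp: qfact_nonzero)
  finally have big: "(\<Prod>j=n0..<n. grid_ratio n n0 k b j) = qfact (c n - c n0) / qfact (k + 1) ^ (n - n0)" .
  have lhs: "(\<Prod>j<n. grid_ratio n n0 k b j) = qfact (c n) / qfact k ^ n0 * (Z / W) / qfact (k + 1) ^ (n - n0)"
    unfolding split small big by (simp add: qfact_nonzero)
  \<comment> \<open>The instance e = 0, written in the shape of
    \<open>prod_qfact_ladder\<close>.\<close>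
  have "(\<Prod>j=0..<n. qfact (c j - 0 + k) / qfact (c j - 0)) = qfact (c n - 0) / (qfact (c 0 - 0) * (\<Prod>l=n0..<n. 1 - q_ind ^ (c (Suc l) - 0)))"
    unfolding c_def by (rule prod_qfact_ladder) auto
  then have "(\<Prod>j<n. qfact (c j + k) / qfact (c j)) = qfact (c n) / W"
    by (simp add: W_def c_def atLeast0LessThan)
  moreover have "(\<Prod>j<n. qfact (c j + k) / (qfact (c j) * qfact k)) =
      (\<Prod>j<n. qfact (c j + k) / qfact (c j)) / qfact k ^ n"
    by (simp add: prod_dividef prod.distrib)
  ultimately have rhs1: "(\<Prod>j<n. qfact (c j + k) / (qfact (c j) * qfact k)) = qfact (c n) / W / qfact k ^ n"
    by (simp only:)
  have "(\<Prod>j=1..n - n0. 1 - q_ind ^ ((k + 1) * j)) = (\<Prod>j<n - n0. 1 - q_ind ^ ((k + 1) * Suc j))"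
    by (simp only: One_nat_def prod.atLeast1_atMost_eq)
  also have "\<dots> = Z"
  proof -
    have "c (Suc (i + n0)) - c n0 = (k + 1) * Suc i" for i by (simp add: c_def ladder_def algebra_simps)
    then show ?thesis
      unfolding Z_def by (subst prod.atLeastLessThan_shift_0) (simp add: atLeast0LessThan add.commute[of n0])
  qed
  finally have rhs2: "(\<Prod>j=1..n - n0. (1 - q_ind ^ ((k + 1) * j)) / (1 - q_ind ^ (k + 1))) =
      Z / (1 - q_ind ^ (k + 1)) ^ (n - n0)"
    by (simp add: prod_dividef)
  have "qfact k ^ n = qfact k ^ n0 * qfact k ^ (n - n0)" using n0 by (simp flip: power_add)
  then show ?thesis
    unfolding lhs c_def[symmetric] rhs1 rhs2
    by (simp add: qfact_Suc power_mult_distrib mult_ac)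
qed

section \<open>The constant term\<close>

context comm_monoid_set
begin

text \<open>Pairs containing x_0 are separated; the other variables are renumbered from 0.\<close>

lemma triangle_split:
  "F (\<lambda>(i, j). g i j) {(i, j). i < j \<and> j \<le> (n::nat)} =
   F (\<lambda>j. g 0 (Suc j)) {..<n} \<^bold>* F (\<lambda>j. F (\<lambda>i. g (Suc i) (Suc j)) {..<j}) {..<n}"
proof (induction n)
  case (Suc n)
  have fin: "finite {(i, j). i < j \<and> j \<le> n}" by (rule finite_Lq_index)
  have eq: "{(i, j). i < j \<and> j \<le> Suc n} = {(i, j). i < j \<and> j \<le> n} \<union> (\<lambda>i. (i, Suc n)) ` {..<Suc n}"
    by (auto simp: le_Suc_eq)
  have "F (\<lambda>(i, j). g i j) {(i, j). i < j \<and> j \<le> Suc n} =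
      F (\<lambda>(i, j). g i j) {(i, j). i < j \<and> j \<le> n} \<^bold>* F (\<lambda>(i, j). g i j) ((\<lambda>i. (i, Suc n)) ` {..<Suc n})"
    unfolding eq by (rule union_disjoint) (use fin in auto)
  also have "F (\<lambda>(i, j). g i j) ((\<lambda>i. (i, Suc n)) ` {..<Suc n}) = F (\<lambda>i. g i (Suc n)) {..<Suc n}"
    by (subst reindex) (auto simp: inj_on_def)
  also have "\<dots> = g 0 (Suc n) \<^bold>* F (\<lambda>i. g (Suc i) (Suc n)) {..<n}"
    by (rule lessThan_Suc_shift)
  finally show ?case
    by (simp add: Suc ac_simps)
next
  case 0
  have *: "{(i, j). i < j \<and> j \<le> (0::nat)} = {}" by auto
  show ?case unfolding * by simp
qed

lemma triangle_swap:
  "F (\<lambda>j. F (\<lambda>i. g i j) {..<j}) {..<(n::nat)} = F (\<lambda>i. F (\<lambda>j. g i j) {Suc i..<n}) {..<n}"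
proof (induction n)
  case (Suc n)
  have "F (\<lambda>i. F (\<lambda>j. g i j) {Suc i..<Suc n}) {..<n} = F (\<lambda>i. F (\<lambda>j. g i j) {Suc i..<n} \<^bold>* g i n) {..<n}"
    by (intro cong) auto
  with Suc show ?case by (simp add: distrib)
qed simp

end

lemma prod_linear_dvd:
  fixes P :: "'a::idom poly"
  assumes "finite S" "inj_on r S" "\<And>s. s \<in> S \<Longrightarrow> poly P (r s) = 0"
  shows "(\<Prod>s\<in>S. [:- r s, 1:]) dvd P"
  using assms
proof (induction S rule: finite_induct)
  case (insert z S)
  then have "(\<Prod>s\<in>S. [:- r s, 1:]) dvd P" by auto
  then obtain Q where Q: "P = (\<Prod>s\<in>S. [:- r s, 1:]) * Q" by (elim dvdE)
  have "poly (\<Prod>s\<in>S. [:- r s, 1:]) (r z) \<noteq> 0"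
    using insert by (auto simp: poly_prod)
  moreover have "poly P (r z) = 0" using insert by simp
  ultimately have "poly Q (r z) = 0" by (simp add: Q)
  then have "[:- r z, 1:] dvd Q" by (simp add: poly_eq_0_iff_dvd)
  then have "(\<Prod>s\<in>S. [:- r s, 1:]) * [:- r z, 1:] dvd P" unfolding Q by (intro mult_dvd_mono) auto
  with insert show ?case by (simp add: mult.commute)
qed simp

section \<open>Clearing denominators and locating zeros\<close>

lemma power_mult_qpoch:
  fixes x :: "'a::field"
  assumes "x \<noteq> 0"
  shows "x ^ r * qpoch q (y / x) r = (\<Prod>s<r. x - q ^ s * y)"
proof -
  have "x ^ r * qpoch q (y / x) r = (\<Prod>s<r. x * (1 - y / x * q ^ s))"
    by (simp add: qpoch_def prod.distrib)
  also have "\<dots> = (\<Prod>s<r. x - q ^ s * y)"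
    using assms by (intro prod.cong) (auto simp: field_simps)
  finally show ?thesis .
qed

lemma power_mult_qpoch_q:
  fixes x :: "'a::field"
  assumes "x \<noteq> 0"
  shows "x ^ r * qpoch q (q * (y / x)) r = (\<Prod>s<r. x - q ^ Suc s * y)"
  using power_mult_qpoch[OF assms, of r q "q * y"] by (simp add: mult_ac)

lemma qpoch_q_power: "qpoch q_ind (q_ind * q_ind ^ N) r = qfact (N + r) / qfact N"
proof -
  have "qpoch q_ind (q_ind * q_ind ^ N) r = (\<Prod>s<r. 1 - q_ind ^ (N + Suc s))"
    by (simp add: qpoch_def power_add mult_ac)
  then show ?thesis by (simp add: qfact_add qfact_nonzero)
qed

text \<open>The factor number w - u is 1 - 1.\<close>

lemma qpoch_quotient_eq_0:
  assumes "u \<le> w" "w < u + r"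
  shows "qpoch q_ind (q_ind ^ u / q_ind ^ w) r = 0"
proof -
  have "q_ind ^ w = q_ind ^ u * q_ind ^ (w - u)" using assms by (simp flip: power_add)
  then have "1 - q_ind ^ u / q_ind ^ w * q_ind ^ (w - u) = 0" by simp
  moreover have "w - u \<in> {..<r}" using assms by auto
  ultimately show ?thesis unfolding qpoch_def by (intro prod_zero) auto
qed

lemma qpoch_q_quotient_eq_0:
  assumes "w < u" "u \<le> w + r"
  shows "qpoch q_ind (q_ind * (q_ind ^ w / q_ind ^ u)) r = 0"
  using qpoch_quotient_eq_0[of "Suc w" u r] assms by simp

lemma ladder_eq_sum: "ladder n0 k j = (\<Sum>i<j. k + of_bool (n0 \<le> i))"
  by (induction j) (simp_all add: ladder_Suc)

lemma ladder_in_grid: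
  assumes "j < n"
  shows "b + ladder n0 k j \<in> grid n n0 k b j"
proof -
  have "ladder n0 k j \<le> ladder n0 k i" if "\<not> n0 \<le> j" "n0 \<le> i" for i
    using that by (intro ladder_mono) auto
  then show ?thesis
    using assms ladder_mono[of j "n - 1" n0 k] by (fastforce simp: grid_def)
qed

text \<open>The part of the product free of x_0. Indices are shifted by one, so the condition that
  x_(i+1) has index above n0 reads \<open>n0 \<le> i\<close>.\<close>

definition cross :: "nat \<Rightarrow> nat \<Rightarrow> nat \<Rightarrow> (nat \<Rightarrow> ratfun) \<Rightarrow> ratfun" where
  "cross n n0 k x = (\<Prod>j<n. \<Prod>i<j.
     qpoch q_ind (x (Suc i) / x (Suc j)) (k + of_bool (n0 \<le> i)) *
     qpoch q_ind (q_ind * (x (Suc j) / x (Suc i))) (k + of_bool (n0 \<le> i)))"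

lemma cross_nonzero_imp_spread:
  assumes "cross n n0 k (\<lambda>i. q_ind ^ \<alpha> i) \<noteq> 0"
  shows "spread n n0 k \<alpha>"
  unfolding spread_def
proof (intro allI impI)
  fix i j assume ij: "1 \<le> i" "i < j" "j \<le> n"
  obtain i' j' where *: "i = Suc i'" "j = Suc j'" "i' < j'" "j' < n"
    using ij by (cases i; cases j) auto
  have "qpoch q_ind (q_ind ^ \<alpha> i / q_ind ^ \<alpha> j) (k + of_bool (n0 < i)) \<noteq> 0"
    "qpoch q_ind (q_ind * (q_ind ^ \<alpha> j / q_ind ^ \<alpha> i)) (k + of_bool (n0 < i)) \<noteq> 0"
    using assms * by (auto simp: cross_def less_Suc_eq_le simp del: times_divide_eq_right)
  then show "(\<alpha> i \<le> \<alpha> j \<longrightarrow> \<alpha> i + (k + of_bool (n0 < i)) \<le> \<alpha> j) \<and>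
      (\<alpha> j < \<alpha> i \<longrightarrow> \<alpha> j + (k + of_bool (n0 < i)) < \<alpha> i)"
    using qpoch_quotient_eq_0[of "\<alpha> i" "\<alpha> j" "k + of_bool (n0 < i)"]
      qpoch_q_quotient_eq_0[of "\<alpha> j" "\<alpha> i" "k + of_bool (n0 < i)"]
    by (meson not_less)
qed

text \<open>The exponent of \<open>X j\<close> is b plus one \<open>\<beta>\<close> for each pair
  containing j. Distributed accordingly, these powers turn all q-shifted factorials into products of
  differences, which are regrouped by variable.\<close>

lemma cross_on_ladder:
  fixes n0 k b :: nat
  defines "X \<equiv> \<lambda>j. q_ind ^ (b + ladder n0 k j)" and "\<beta> \<equiv> \<lambda>j. k + of_bool (n0 \<le> j)"
  shows "(\<Prod>j<n. X j ^ (b + ladder n0 k j + (n - 1 - j) * \<beta> j) /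
       (\<Prod>\<gamma>\<in>grid n n0 k b j - {b + ladder n0 k j}. X j - q_ind ^ \<gamma>)) *
    ((\<Prod>j<n. qpoch q_ind (1 / X j) b) * cross n n0 k (\<lambda>i. X (i - 1))) =
    (\<Prod>j<n. grid_ratio n n0 k b j)"
proof -
  have X0: "X j \<noteq> 0" for j by (simp add: X_def)
  define D where "D j = (\<Prod>\<gamma>\<in>grid n n0 k b j - {b + ladder n0 k j}. X j - q_ind ^ \<gamma>)" for j
  have pw: "X j ^ (b + ladder n0 k j + (n - 1 - j) * \<beta> j) =
      X j ^ b * (\<Prod>i<j. X j ^ \<beta> i) * (\<Prod>l=Suc j..<n. X j ^ \<beta> j)" for j
    unfolding ladder_eq_sum \<beta>_def[symmetric]
    by (simp add: power_add power_sum flip: power_mult) (simp add: mult.commute)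
  have "(\<Prod>j<n. \<Prod>i<j. X j ^ \<beta> i) * (\<Prod>j<n. \<Prod>l=Suc j..<n. X j ^ \<beta> j) * cross n n0 k (\<lambda>i. X (i - 1)) =
      (\<Prod>j<n. \<Prod>i<j. (\<Prod>s<\<beta> i. X j - q_ind ^ s * X i) * (\<Prod>s<\<beta> i. X i - q_ind ^ Suc s * X j))"
  proof -
    have 1: "(\<Prod>j<n. \<Prod>l=Suc j..<n. X j ^ \<beta> j) = (\<Prod>j<n. \<Prod>i<j. X i ^ \<beta> i)"
      by (rule prod.triangle_swap[symmetric])
    have 2: "cross n n0 k (\<lambda>i. X (i - 1)) =
        (\<Prod>j<n. \<Prod>i<j. qpoch q_ind (X i / X j) (\<beta> i) * qpoch q_ind (q_ind * (X j / X i)) (\<beta> i))"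
      by (simp only: cross_def \<beta>_def diff_Suc_1)
    show ?thesis
      unfolding 1 2 power_mult_qpoch[OF X0, symmetric] power_mult_qpoch_q[OF X0, symmetric]
      by (simp only: prod.distrib mult_ac)
  qed
  also have "\<dots> = (\<Prod>j<n. (\<Prod>i<j. \<Prod>s<\<beta> i. X j - q_ind ^ s * X i) *
      (\<Prod>l=Suc j..<n. \<Prod>s<\<beta> j. X j - q_ind ^ Suc s * X l))"
    unfolding prod.distrib prod.triangle_swap[where g = "\<lambda>i j. \<Prod>s<\<beta> i. X i - q_ind ^ Suc s * X j"] ..
  finally have cr: "(\<Prod>j<n. \<Prod>i<j. X j ^ \<beta> i) * (\<Prod>j<n. \<Prod>l=Suc j..<n. X j ^ \<beta> j) * cross n n0 k (\<lambda>i. X (i - 1)) =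
    (\<Prod>j<n. (\<Prod>i<j. \<Prod>s<\<beta> i. X j - q_ind ^ s * X i) *
      (\<Prod>l=Suc j..<n. \<Prod>s<\<beta> j. X j - q_ind ^ Suc s * X l))" .
  have gr: "grid_ratio n n0 k b j = (X j ^ b * qpoch q_ind (1 / X j) b) *
      ((\<Prod>i<j. \<Prod>s<\<beta> i. X j - q_ind ^ s * X i) * (\<Prod>l=Suc j..<n. \<Prod>s<\<beta> j. X j - q_ind ^ Suc s * X l)) / D j" for j
  proof -
    have "(\<Prod>\<gamma><b + ladder n0 k j. X j - q_ind ^ \<gamma>) =
        (\<Prod>s<b. X j - q_ind ^ s) * (\<Prod>i<j. \<Prod>s<\<beta> i. X j - q_ind ^ s * X i)"
      unfolding prod_lessThan_ladder \<beta>_def by (simp add: X_def power_add mult_ac)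
    moreover have "X j ^ b * qpoch q_ind (1 / X j) b = (\<Prod>s<b. X j - q_ind ^ s)"
      by (simp add: power_mult_qpoch[OF X0])
    ultimately show ?thesis
      unfolding grid_ratio_def X_def[symmetric] \<beta>_def[symmetric] D_def by (simp add: X_def \<beta>_def mult_ac)
  qed
  have "(\<Prod>j<n. X j ^ (b + ladder n0 k j + (n - 1 - j) * \<beta> j) / D j) *
    ((\<Prod>j<n. qpoch q_ind (1 / X j) b) * cross n n0 k (\<lambda>i. X (i - 1))) =
    (\<Prod>j<n. X j ^ b * qpoch q_ind (1 / X j) b) *
    ((\<Prod>j<n. \<Prod>i<j. X j ^ \<beta> i) * (\<Prod>j<n. \<Prod>l=Suc j..<n. X j ^ \<beta> j) * cross n n0 k (\<lambda>i. X (i - 1))) / (\<Prod>j<n. D j)"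
    unfolding pw prod_dividef prod.distrib by (simp only: divide_inverse mult_ac)
  also have "\<dots> = (\<Prod>j<n. grid_ratio n n0 k b j)"
    unfolding cr gr prod_dividef prod.distrib ..
  finally show ?thesis unfolding D_def .
qed

lemma balanced_Lq_split:
  "balanced n (\<lambda>l. case l of 0 \<Rightarrow> (\<Sum>j<n. B (Suc j) 0)
     | Suc j \<Rightarrow> B 0 (Suc j) + (\<Sum>i<j. B (Suc i) (Suc j)) + (\<Sum>i=Suc j..<n. B (Suc i) (Suc j))) (Lq n B)"
proof -
  define d where "d l = (\<Sum>(i, j) \<in> {(i, j). i < j \<and> j \<le> n}.
     of_bool (l = j) * B i j + of_bool (l = i) * B j i)" for l
  have d: "d l = (\<Sum>j<n. of_bool (l = Suc j) * B 0 (Suc j) + of_bool (l = 0) * B (Suc j) 0) +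
      ((\<Sum>j<n. \<Sum>i<j. of_bool (l = Suc j) * B (Suc i) (Suc j)) +
       (\<Sum>i<n. \<Sum>j=Suc i..<n. of_bool (l = Suc i) * B (Suc j) (Suc i)))" for l
    unfolding d_def sum.triangle_split sum.triangle_swap[symmetric] by (simp add: sum.distrib)
  have le: "d l \<le> (case l of 0 \<Rightarrow> (\<Sum>j<n. B (Suc j) 0)
     | Suc j \<Rightarrow> B 0 (Suc j) + (\<Sum>i<j. B (Suc i) (Suc j)) + (\<Sum>i=Suc j..<n. B (Suc i) (Suc j)))" for l
  proof (cases l)
    case 0
    then show ?thesis by (simp add: d)
  next
    case (Suc j)
    \<comment> \<open>Only an inequality: for j \<ge> n the left side is 0.\<close>
    have *: "(\<Sum>i<n. of_bool (j = i) * f i) \<le> f j" for f :: "nat \<Rightarrow> nat"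
      by (simp add: of_bool_def if_distrib[of "\<lambda>x. x * _"] cong: if_cong)
    have "d l = (\<Sum>i<n. of_bool (j = i) * B 0 (Suc i)) +
        ((\<Sum>i<n. of_bool (j = i) * (\<Sum>i'<i. B (Suc i') (Suc i))) +
         (\<Sum>i<n. of_bool (j = i) * (\<Sum>j'=Suc i..<n. B (Suc j') (Suc i))))"
      by (simp add: d Suc sum_distrib_left)
    also have "\<dots> \<le> B 0 (Suc j) + ((\<Sum>i'<j. B (Suc i') (Suc j)) + (\<Sum>j'=Suc j..<n. B (Suc j') (Suc j)))"
      by (intro add_mono *)
    finally show ?thesis by (simp add: Suc)
  qed
  show ?thesis
    by (rule balanced_mono[OF balanced_Lq[of n B, folded d_def] le])
qed

text \<open>The polynomial is \<open>t\<^sup>A (t/x)\<^sub>b (qx/t)\<^sub>A\<close>, as a function of \<open>t = x\<^sub>0\<close>.\<close>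

definition x0_factor :: "nat \<Rightarrow> nat \<Rightarrow> ratfun \<Rightarrow> ratfun poly" where
  "x0_factor b A x = (\<Prod>s<b. [:1, - (q_ind ^ s / x):]) * (\<Prod>s<A. [:- (q_ind ^ Suc s * x), 1:])"

lemma poly_x0_factor:
  assumes "t \<noteq> 0"
  shows "poly (x0_factor b A x) t = t ^ A * (qpoch q_ind (t / x) b * qpoch q_ind (q_ind * (x / t)) A)"
proof -
  have "poly (x0_factor b A x) t = qpoch q_ind (t / x) b * (\<Prod>s<A. t - q_ind ^ Suc s * x)"
    by (simp add: x0_factor_def poly_prod qpoch_def mult_ac)
  also have "(\<Prod>s<A. t - q_ind ^ Suc s * x) = t ^ A * qpoch q_ind (q_ind * (x / t)) A"
    by (rule power_mult_qpoch_q[OF assms, symmetric])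
  finally show ?thesis by (simp only: mult_ac)
qed

text \<open>At x = q^\<alpha> the roots are q^\<gamma> for the consecutive integers \<alpha> - b <
  \<gamma> \<le> \<alpha> + A; the hypotheses place c + 1, ..., c + r among them.\<close>

lemma x0_factor_dvd:
  assumes "\<alpha> \<le> b + c" "c + r \<le> \<alpha> + A"
  shows "(\<Prod>s<r. [:- (q_ind ^ (c + Suc s)), 1:]) dvd x0_factor b A (q_ind ^ \<alpha>)"
proof (rule prod_linear_dvd)
  show "inj_on (\<lambda>s. q_ind ^ (c + Suc s)) {..<r}"
    by (simp add: inj_on_def q_ind_power_eq_iff del: power_Suc add_Suc_right)
  fix s assume s: "s \<in> {..<r}"
  define \<gamma> where "\<gamma> = c + Suc s"
  show "poly (x0_factor b A (q_ind ^ \<alpha>)) (q_ind ^ (c + Suc s)) = 0"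
  proof (cases "\<gamma> \<le> \<alpha>")
    case True
    then have "qpoch q_ind (q_ind ^ \<gamma> / q_ind ^ \<alpha>) b = 0"
      using assms s by (intro qpoch_quotient_eq_0) (auto simp: \<gamma>_def)
    then show ?thesis by (subst poly_x0_factor) (simp_all add: \<gamma>_def)
  next
    case False
    then have "qpoch q_ind (q_ind * (q_ind ^ \<alpha> / q_ind ^ \<gamma>)) A = 0"
      using assms s by (intro qpoch_q_quotient_eq_0) (auto simp: \<gamma>_def)
    then show ?thesis by (subst poly_x0_factor) (simp_all add: \<gamma>_def)
  qed
qed simp

lemma monic_dvd_imp_eq_smult:
  fixes g h :: "'a::field poly"
  assumes "h dvd g" "lead_coeff h = 1" "degree g \<le> degree h"
  shows "g = smult (coeff g (degree h)) h"
proof -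
  obtain u where u: "g = h * u" using assms(1) by (elim dvdE)
  have h0: "h \<noteq> 0" using assms(2) by auto
  show ?thesis
  proof (cases "u = 0")
    case False
    then have "degree u = 0" using assms(3) h0 by (simp add: u degree_mult_eq)
    then obtain e where "u = [:e:]" by (elim degree_eq_zeroE)
    then have "g = smult e h" by (simp add: u)
    then show ?thesis using assms(2) by simp
  qed (simp add: u)
qed

theorem theorem7:
  fixes n a b k m n0 :: nat
    and B :: "nat \<Rightarrow> nat \<Rightarrow> nat"
  assumes "n > 0"
    and "m \<le> n" and "n0 \<le> n" and "n \<le> m + n0"
    and "\<And>i. i \<le> n \<Longrightarrow> B i i = 0"
    and "\<And>j. 1 \<le> j \<Longrightarrow> j \<le> n \<Longrightarrow> B 0 j = b"
    and "\<And>i. 1 \<le> i \<Longrightarrow> i \<le> n - m \<Longrightarrow> B i 0 = a"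
    and "\<And>i. n - m < i \<Longrightarrow> i \<le> n \<Longrightarrow> B i 0 = a + 1"
    and "\<And>i j. 1 \<le> i \<Longrightarrow> i \<le> n \<Longrightarrow> 1 \<le> j \<Longrightarrow> j \<le> n \<Longrightarrow> i \<noteq> j \<Longrightarrow>
           B i j = (if i > n0 \<and> j > n0 then k + 1 else k)"
  shows "CT (Lq n B) =
    (\<Prod>j = 0..<n.
       (qfact (a + b + k * j + of_bool (j > n0) * (j - n0) + of_bool (j \<ge> n - m)) *
        qfact (k * j + of_bool (j > n0) * (j - n0) + k)) /
       (qfact (a + k * j + of_bool (j > n0) * (j - n0) + of_bool (j \<ge> n - m)) *
        qfact (b + k * j + of_bool (j > n0) * (j - n0)) *
        qfact k)) *
    (\<Prod>j = 1..n - n0. (1 - q_ind ^ ((k + 1) * j)) / (1 - q_ind ^ (k + 1)))"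
proof -
  define c where "c = ladder n0 k"
  \<comment> \<open>The entry of B in row j + 1 and column 0.\<close>
  define A where "A j = a + of_bool (n - m \<le> j)" for j
  define \<beta> where "\<beta> i = k + of_bool (n0 \<le> i)" for i
  have B0: "B 0 (Suc j) = b" "B (Suc j) 0 = A j" if "j < n" for j
    using that assms(6)[of "Suc j"] assms(7)[of "Suc j"] assms(8)[of "Suc j"]
    by (auto simp: A_def not_le less_Suc_eq_le)
  have BS: "B (Suc i) (Suc j) = \<beta> i" "B (Suc j) (Suc i) = \<beta> i" if "i < j" "j < n" for i j
    using that assms(9)[of "Suc i" "Suc j"] assms(9)[of "Suc j" "Suc i"]
    by (auto simp: \<beta>_def less_Suc_eq_le)
  define d where "d l = (case l of 0 \<Rightarrow> (\<Sum>j<n. B (Suc j) 0)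
     | Suc j \<Rightarrow> B 0 (Suc j) + (\<Sum>i<j. B (Suc i) (Suc j)) + (\<Sum>i=Suc j..<n. B (Suc i) (Suc j)))" for l
  have d0: "d 0 = (\<Sum>j<n. A j)" by (simp add: d_def B0)
  have dS: "d (Suc j) = b + c j + (n - 1 - j) * \<beta> j" if "j < n" for j
    using that by (simp add: d_def B0 BS c_def ladder_eq_sum \<beta>_def[symmetric])
  define E where "E l = grid n n0 k b (l - 1)" for l
  have finE: "finite (E l)" for l by (simp add: E_def grid_def)
  have cardE: "card (E l) = Suc (d l)" if ln: "l \<in> {1..n}" for l
  proof -
    obtain j where j: "l = Suc j" "j < n" using ln by (cases l) auto
    then obtain e where l: "l = Suc j" "n = Suc (j + e)" using less_imp_Suc_add by blast
    show ?thesis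
      using card_grid[of j n n0 k b] dS[of j]
      by (auto simp: l E_def c_def \<beta>_def ladder_def algebra_simps)
  qed
  define v where "v i = q_ind ^ i" for i :: nat
  have v: "inj v" "v i \<noteq> 0" for i by (auto simp: v_def inj_def q_ind_power_eq_iff)
  define M where "M \<alpha> = (\<Prod>j=1..n. v (\<alpha> j) ^ d j / (\<Prod>l\<in>E j - {\<alpha> j}. v (\<alpha> j) - v l))" for \<alpha>
  define K where "K \<alpha> = cross n n0 k (\<lambda>i. v (\<alpha> i))" for \<alpha>
  define P where "P \<alpha> = (\<Prod>j<n. x0_factor b (A j) (v (\<alpha> (Suc j))))" for \<alpha>
  define H where "H = (\<Prod>i<n. \<Prod>s<A i. [:- (q_ind ^ (c i + Suc s)), 1:])"

  \<comment> \<open>The interpolated polynomial in x_0\<close>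
  have bal: "balanced n d (Lq n B)"
    using balanced_Lq_split unfolding d_def .
  obtain g where g: "degree g \<le> d 0" "coeff g (d 0) = CT (Lq n B)"
    "\<And>t. t \<noteq> 0 \<Longrightarrow> poly g t = (\<Sum>\<alpha>\<in>PiE {1..n} E. M \<alpha> *
       (t ^ d 0 * leval n (\<lambda>i. if i = 0 then t else v (\<alpha> i)) (Lq n B)))"
    by (rule CT_by_interpolation[OF bal v finE cardE, folded M_def]) (assumption, rule that)
  have "t ^ d 0 * leval n (\<lambda>i. if i = 0 then t else v (\<alpha> i)) (Lq n B) = poly (P \<alpha>) t * K \<alpha>"
    if t: "t \<noteq> 0" for t \<alpha>
  proof -
    have "leval n (\<lambda>i. if i = 0 then t else v (\<alpha> i)) (Lq n B) =
        (\<Prod>j<n. qpoch q_ind (t / v (\<alpha> (Suc j))) (B 0 (Suc j)) * qpoch q_ind (q_ind * (v (\<alpha> (Suc j)) / t)) (B (Suc j) 0)) *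
        (\<Prod>j<n. \<Prod>i<j. qpoch q_ind (v (\<alpha> (Suc i)) / v (\<alpha> (Suc j))) (B (Suc i) (Suc j)) *
           qpoch q_ind (q_ind * (v (\<alpha> (Suc j)) / v (\<alpha> (Suc i)))) (B (Suc j) (Suc i)))"
      using t v(2) by (subst leval_Lq) (simp_all add: prod.triangle_split del: times_divide_eq_right)
    also have "\<dots> = (\<Prod>j<n. qpoch q_ind (t / v (\<alpha> (Suc j))) b * qpoch q_ind (q_ind * (v (\<alpha> (Suc j)) / t)) (A j)) * K \<alpha>"
      unfolding K_def cross_def by (simp add: B0 BS \<beta>_def del: times_divide_eq_right)
    finally show ?thesis
      by (simp add: P_def poly_prod poly_x0_factor[OF t] d0 power_sum prod.distrib del: times_divide_eq_right)
  qed
  with g(3) have gt: "poly g t = (\<Sum>\<alpha>\<in>PiE {1..n} E. M \<alpha> * (poly (P \<alpha>) t * K \<alpha>))" if "t \<noteq> 0" for t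
    using that by simp
  \<comment> \<open>Both sides agree at every nonzero t, and the powers of q supply enough such
    points.\<close>
  have g_eq: "g = (\<Sum>\<alpha>\<in>PiE {1..n} E. smult (M \<alpha> * K \<alpha>) (P \<alpha>))" (is "g = ?G")
  proof (rule poly_eqI_degree)
    fix t assume "t \<in> v ` {..max (degree g) (degree ?G)}"
    then have "t \<noteq> 0" using v(2) by auto
    then show "poly g t = poly ?G t" by (simp add: gt poly_sum mult_ac)
  next
    have "card (v ` {..max (degree g) (degree ?G)}) = Suc (max (degree g) (degree ?G))"
      using v(1) by (subst card_image) (auto intro: inj_on_subset)
    then show "degree g < card (v ` {..max (degree g) (degree ?G)})"
      "degree ?G < card (v ` {..max (degree g) (degree ?G)})" by auto
  qed

  \<comment> \<open>Divisibility of every summand by H\<close>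
  have gridD: "\<alpha> j \<le> b + c (n - 1)" "j \<le> n0 \<Longrightarrow> n0 \<le> i \<Longrightarrow> Suc i < n \<Longrightarrow> \<alpha> j \<noteq> Suc (b + c i)"
    if "\<alpha> \<in> PiE {1..n} E" "j \<in> {1..n}" for \<alpha> i j
  proof -
    have "\<alpha> j \<in> grid n n0 k b (j - 1)" using that by (auto simp: E_def PiE_iff)
    then show "\<alpha> j \<le> b + c (n - 1)" "j \<le> n0 \<Longrightarrow> n0 \<le> i \<Longrightarrow> Suc i < n \<Longrightarrow> \<alpha> j \<noteq> Suc (b + c i)"
      using that(2) by (auto simp: grid_def c_def split: if_splits)
  qed
  have sorted: thesis
    if \<alpha>: "\<alpha> \<in> PiE {1..n} E" "K \<alpha> \<noteq> 0" and thesis: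
      "\<And>\<pi>. bij_betw \<pi> {..<n} {1..n} \<Longrightarrow> (\<And>i. i < n \<Longrightarrow> c i \<le> \<alpha> (\<pi> i)) \<Longrightarrow>
        (\<And>i. i < n \<Longrightarrow> \<alpha> (\<pi> i) \<le> b + c i) \<Longrightarrow>
        (\<And>i. i < n \<Longrightarrow> n - m \<le> i \<Longrightarrow> \<pi> i \<le> n - m \<Longrightarrow> c i < \<alpha> (\<pi> i)) \<Longrightarrow>
        (\<forall>j\<in>{1..n}. b \<le> \<alpha> j \<Longrightarrow> \<forall>j\<in>{1..n}. \<alpha> j = b + c (j - 1)) \<Longrightarrow> thesis"
    for \<alpha> thesis
  proof (rule spread_sorted[of n n0 k \<alpha> m b, folded c_def])
    show "spread n n0 k \<alpha>"
      using \<alpha>(2) unfolding K_def v_def by (rule cross_nonzero_imp_spread)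
    show "n \<le> m + n0" "n0 \<le> n" by fact+
    show "\<alpha> j \<le> b + c (n - 1)" if "j \<in> {1..n}" for j
      by (rule gridD(1)[OF \<alpha>(1) that])
    show "\<alpha> j \<noteq> Suc (b + c i)" if "j \<in> {1..n0}" "n0 \<le> i" "Suc i < n" for i j
      by (rule gridD(2)[OF \<alpha>(1)]) (use that assms(3) in auto)
  qed (rule thesis)

  have H_dvd: "H dvd P \<alpha>" if \<alpha>: "\<alpha> \<in> PiE {1..n} E" "K \<alpha> \<noteq> 0" for \<alpha>
  proof (rule sorted[OF \<alpha>])
    fix \<pi> assume \<pi>: "bij_betw \<pi> {..<n} {1..n}" "\<And>i. i < n \<Longrightarrow> c i \<le> \<alpha> (\<pi> i)"
      "\<And>i. i < n \<Longrightarrow> \<alpha> (\<pi> i) \<le> b + c i"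
      "\<And>i. i < n \<Longrightarrow> n - m \<le> i \<Longrightarrow> \<pi> i \<le> n - m \<Longrightarrow> c i < \<alpha> (\<pi> i)"
    have "P \<alpha> = (\<Prod>j=1..n. x0_factor b (A (j - 1)) (v (\<alpha> j)))"
      by (simp add: P_def prod.atLeast1_atMost_eq)
    also have "\<dots> = (\<Prod>i<n. x0_factor b (A (\<pi> i - 1)) (v (\<alpha> (\<pi> i))))"
      by (rule prod.reindex_bij_betw[OF \<pi>(1), symmetric])
    finally have P: "P \<alpha> = (\<Prod>i<n. x0_factor b (A (\<pi> i - 1)) (v (\<alpha> (\<pi> i))))" .
    show "H dvd P \<alpha>"
      unfolding H_def P
    proof (rule prod_dvd_prod)
      fix i assume "i \<in> {..<n}"
      then have i: "i < n" by simp
      have "\<pi> i \<in> {1..n}" using \<pi>(1) i by (auto simp: bij_betw_def)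
      \<comment> \<open>\<open>A (\<pi> i - 1)\<close> falls short of \<open>A i\<close> only if n -
        m \<le> i and \<open>\<pi> i \<le> n - m\<close>; then it does so by one, and the strict
        lower bound makes up for it.\<close>
      then have "c i + A i \<le> \<alpha> (\<pi> i) + A (\<pi> i - 1)"
        using \<pi>(2)[OF i] \<pi>(4)[OF i] by (cases "\<pi> i \<le> n - m"; cases "n - m \<le> i") (auto simp: A_def)
      then show "(\<Prod>s<A i. [:- (q_ind ^ (c i + Suc s)), 1:]) dvd x0_factor b (A (\<pi> i - 1)) (v (\<alpha> (\<pi> i)))"
        unfolding v_def using \<pi>(3)[OF i] by (intro x0_factor_dvd)
    qed
  qed
  have "H dvd g"
    unfolding g_eq
  proof (rule dvd_sum)
    fix \<alpha> assume \<alpha>: "\<alpha> \<in> PiE {1..n} E"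
    show "H dvd smult (M \<alpha> * K \<alpha>) (P \<alpha>)"
      using H_dvd[OF \<alpha>] by (cases "K \<alpha> = 0") (auto intro: dvd_smult)
  qed
  moreover have "lead_coeff H = 1"
    by (simp add: H_def lead_coeff_prod)
  moreover have degH: "degree H = d 0"
    by (simp add: H_def d0 degree_prod_eq_sum_degree)
  ultimately have "g = smult (CT (Lq n B)) H"
    using monic_dvd_imp_eq_smult[of H g] g(1,2) by simp
  then have g1: "poly g 1 = CT (Lq n B) * poly H 1" by simp

  \<comment> \<open>Evaluation at t = 1\<close>
  define X where "X j = q_ind ^ (b + c j)" for j
  define \<alpha>0 where "\<alpha>0 = (\<lambda>j\<in>{1..n}. b + c (j - 1))"
  have \<alpha>0: "\<alpha>0 \<in> PiE {1..n} E"
    using ladder_in_grid[of _ n b n0 k] by (auto simp: \<alpha>0_def E_def c_def)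
  have P1: "poly (P \<alpha>) 1 = (\<Prod>j<n. qpoch q_ind (1 / v (\<alpha> (Suc j))) b * qpoch q_ind (q_ind * v (\<alpha> (Suc j))) (A j))" for \<alpha>
    by (simp add: P_def poly_prod poly_x0_factor)
  have vanish: "M \<alpha> * (poly (P \<alpha>) 1 * K \<alpha>) = 0" if \<alpha>: "\<alpha> \<in> PiE {1..n} E" "\<alpha> \<noteq> \<alpha>0" for \<alpha>
  proof (rule ccontr)
    assume "\<not> ?thesis"
    then have nz: "K \<alpha> \<noteq> 0" "poly (P \<alpha>) 1 \<noteq> 0" by auto
    \<comment> \<open>At t = 1 the factor (1/x_j)_b vanishes when the exponent of x_j is below
      b.\<close>
    have ge: "\<forall>j\<in>{1..n}. b \<le> \<alpha> j"
    proof (intro ballI, rule ccontr)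
      fix j assume j: "j \<in> {1..n}" and "\<not> b \<le> \<alpha> j"
      then have "qpoch q_ind (q_ind ^ 0 / q_ind ^ \<alpha> j) b = 0" by (intro qpoch_quotient_eq_0) auto
      moreover obtain j' where "j = Suc j'" "j' < n" using j by (cases j) auto
      ultimately show False using nz(2) by (auto simp: P1 v_def)
    qed
    then have "\<forall>j\<in>{1..n}. \<alpha> j = b + c (j - 1)"
      using sorted[OF \<alpha>(1) nz(1)] by blast
    then have "\<alpha> = \<alpha>0"
      using \<alpha>(1) by (auto simp: \<alpha>0_def PiE_iff extensional_def fun_eq_iff)
    with \<alpha>(2) show False ..
  qed
  have "poly g 1 = M \<alpha>0 * (poly (P \<alpha>0) 1 * K \<alpha>0)"
    using gt[of 1] sum.mono_neutral_right[of "PiE {1..n} E" "{\<alpha>0}" "\<lambda>\<alpha>. M \<alpha> * (poly (P \<alpha>) 1 * K \<alpha>)"]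
      \<alpha>0 vanish finE by (auto simp: finite_PiE)
  also have "\<dots> = (\<Prod>j<n. X j ^ (b + c j + (n - 1 - j) * \<beta> j) /
        (\<Prod>\<gamma>\<in>grid n n0 k b j - {b + c j}. X j - q_ind ^ \<gamma>)) *
      ((\<Prod>j<n. qpoch q_ind (1 / X j) b) * cross n n0 k (\<lambda>i. X (i - 1))) * (\<Prod>j<n. qpoch q_ind (q_ind * X j) (A j))"
  proof -
    have "M \<alpha>0 = (\<Prod>j<n. X j ^ (b + c j + (n - 1 - j) * \<beta> j) /
        (\<Prod>\<gamma>\<in>grid n n0 k b j - {b + c j}. X j - q_ind ^ \<gamma>))"
      unfolding M_def One_nat_def prod.atLeast1_atMost_eq
      by (intro prod.cong) (auto simp: \<alpha>0_def dS E_def v_def X_def)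
    moreover have "K \<alpha>0 = cross n n0 k (\<lambda>i. X (i - 1))"
      unfolding K_def cross_def by (intro prod.cong) (auto simp: \<alpha>0_def v_def X_def)
    moreover have "poly (P \<alpha>0) 1 = (\<Prod>j<n. qpoch q_ind (1 / X j) b) * (\<Prod>j<n. qpoch q_ind (q_ind * X j) (A j))"
      unfolding P1 prod.distrib[symmetric] by (intro prod.cong) (auto simp: \<alpha>0_def v_def X_def)
    ultimately show ?thesis by (simp only: mult_ac)
  qed
  also have "\<dots> = (\<Prod>j<n. grid_ratio n n0 k b j) * (\<Prod>j<n. qfact (b + c j + A j) / qfact (b + c j))"
    unfolding X_def \<beta>_def c_def cross_on_ladder qpoch_q_power ..
  finally have "CT (Lq n B) * poly H 1 =
      (\<Prod>j<n. grid_ratio n n0 k b j) * (\<Prod>j<n. qfact (b + c j + A j) / qfact (b + c j))"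
    using g1 by simp
  moreover have H1: "poly H 1 = (\<Prod>j<n. qfact (c j + A j) / qfact (c j))"
    by (simp add: H_def poly_prod qfact_add qfact_nonzero)
  \<comment> \<open>All roots of H are positive powers of q, so dividing by its value at 1 is
    allowed.\<close>
  moreover have "poly H 1 \<noteq> 0" by (simp add: H1 qfact_nonzero)
  ultimately have "CT (Lq n B) = (\<Prod>j<n. grid_ratio n n0 k b j) *
      (\<Prod>j<n. qfact (b + c j + A j) / qfact (b + c j)) / (\<Prod>j<n. qfact (c j + A j) / qfact (c j))"
    by (simp only: eq_divide_eq) simp
  also have "\<dots> = (\<Prod>j<n. qfact (b + c j + A j) * qfact (c j + k) / (qfact (c j + A j) * qfact (b + c j) * qfact k)) *
      (\<Prod>j = 1..n - n0. (1 - q_ind ^ ((k + 1) * j)) / (1 - q_ind ^ (k + 1)))"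
    unfolding prod_grid_ratio[OF assms(3)] c_def[symmetric]
    by (simp add: prod_dividef prod.distrib qfact_nonzero mult_ac)
  also have "(\<Prod>j<n. qfact (b + c j + A j) * qfact (c j + k) / (qfact (c j + A j) * qfact (b + c j) * qfact k)) =
    (\<Prod>j = 0..<n.
       (qfact (a + b + k * j + of_bool (j > n0) * (j - n0) + of_bool (j \<ge> n - m)) *
        qfact (k * j + of_bool (j > n0) * (j - n0) + k)) /
       (qfact (a + k * j + of_bool (j > n0) * (j - n0) + of_bool (j \<ge> n - m)) *
        qfact (b + k * j + of_bool (j > n0) * (j - n0)) *
        qfact k))"
    unfolding atLeast0LessThan
  proof (intro prod.cong refl)
    fix j
    have c: "c j = k * j + of_bool (j > n0) * (j - n0)" by (simp add: c_def ladder_def)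
    show "qfact (b + c j + A j) * qfact (c j + k) / (qfact (c j + A j) * qfact (b + c j) * qfact k) =
      (qfact (a + b + k * j + of_bool (j > n0) * (j - n0) + of_bool (j \<ge> n - m)) *
        qfact (k * j + of_bool (j > n0) * (j - n0) + k)) /
       (qfact (a + k * j + of_bool (j > n0) * (j - n0) + of_bool (j \<ge> n - m)) *
        qfact (b + k * j + of_bool (j > n0) * (j - n0)) *
        qfact k)"
      unfolding c A_def by (simp only: add_ac)
  qed
  finally show ?thesis .
qed

end
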